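(* Let $C$ be a real number with $1<C<\frac{3}{2}$, and let $n,k$ be integers with $k\geq 3$ and $n\geq \frac{42k}{3-2C}$. Suppose that $\mathcal{F}\subset\binom{[n]}{k}$ is an intersecting family. Then \[ \gamma_C(\mathcal{F})\leq (3-2C)\binom{n-3}{k-2}, \] with equality if and only if $\mathcal{F}$ is equal, up to isomorphism (i.e. up to a permutation of $[n]$), to the family $\mathcal{F}_{\bigtriangleup}=\left\{F\in\binom{[n]}{k}\colon |F\cap\{1,2,3\}|=2\right\}$.
   Context: $[n]=\{1,\ldots,n\}$ and $\binom{[n]}{k}$ is the collection of all $k$-element subsets of $[n]$. A family $\mathcal{F}\subset\binom{[n]}{k}$ is intersecting if $F\cap F'\neq\emptyset$ for all $F,F'\in\mathcal{F}$. For $x\in[n]$, $\mathcal{F}(x)=\{F\setminus\{x\}\colon x\in F\in\mathcal{F}\}$, and $\Delta(\mathcal{F})=\max_{1\leq x\leq n}|\mathcal{F}(x)|$ is the maximum degree. The $C$-diversity of $\mathcal{F}$ is $\gamma_C(\mathcal{F})=|\mathcal{F}|-C\Delta(\mathcal{F})$. *)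

theory Defs
  imports Complex_Main "HOL-Combinatorics.Permutations"
begin

definition k_subsets :: "nat \<Rightarrow> nat \<Rightarrow> nat set set" where
  "k_subsets n k = {F. F \<subseteq> {1..n} \<and> card F = k}"

definition intersecting :: "nat set set \<Rightarrow> bool" where
  "intersecting \<F> \<longleftrightarrow> (\<forall>F\<in>\<F>. \<forall>F'\<in>\<F>. F \<inter> F' \<noteq> {})"

definition link :: "nat set set \<Rightarrow> nat \<Rightarrow> nat set set" where
  "link \<F> x = {F - {x} | F. F \<in> \<F> \<and> x \<in> F}"

text \<open>The maximum is over the whole ground set \<open>{1..n}\<close>, so it is 0 for the empty family;
  \<open>Max\<close> is unspecified only when \<open>n = 0\<close>.\<close>

definition max_degree :: "nat \<Rightarrow> nat set set \<Rightarrow> nat" where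
  "max_degree n \<F> = Max ((\<lambda>x. card (link \<F> x)) ` {1..n})"

definition diversity :: "real \<Rightarrow> nat \<Rightarrow> nat set set \<Rightarrow> real" where
  "diversity C n \<F> = real (card \<F>) - C * real (max_degree n \<F>)"

definition triangle_family :: "nat \<Rightarrow> nat \<Rightarrow> nat set set" where
  "triangle_family n k = {F \<in> k_subsets n k. card (F \<inter> {1, 2, 3}) = 2}"

text \<open>Isomorphism of families on the ground set \<open>{1..n}\<close>: one is carried to the other by a
  permutation of the ground set.\<close>

definition isomorphic_families :: "nat \<Rightarrow> nat set set \<Rightarrow> nat set set \<Rightarrow> bool" where
  "isomorphic_families n \<F> \<G> \<longleftrightarrow> (\<exists>\<pi>. \<pi> permutes {1..n} \<and> \<F> = (\<lambda>F. \<pi> ` F) ` \<G>)"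

end

theory Submission
  imports Defs
begin

text \<open>
  Put \<open>u = (n - 4) choose (k - 3)\<close>. If the diversity reaches the claimed bound, then every vertex
  is missed by at least \<open>42 * u\<close> sets. By the Kruskal--Katona theorem, a vertex whose
  degree exceeds a small multiple of \<open>u\<close> in one of two large cross-intersecting families lies in nearly all sets
  of the other, so degrees have gaps. One shift at most doubles a degree; hence degrees that start
  below a gap stay below it during the whole shifting process, whereas a large shifted family has
  a vertex of large degree. This yields vertices \<open>x\<close>, \<open>y\<close>, \<open>z\<close> such that only few sets meet
  \<open>{x, y, z}\<close> in at most one point. A second application of Kruskal--Katona bounds the
  number of these exceptional sets by a small multiple of the number of sets missing from the
  triangle family, and averaging the degrees of \<open>x\<close>, \<open>y\<close>, \<open>z\<close> gives the bound together with the
  case of equality.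
\<close>

section \<open>Shifting\<close>

text \<open>A shift keeps sizes and intersections but may raise the degree of the smaller of its two
  vertices, so large diversity does not survive shifting. Hence nothing is said about the diversity
  of shifted families: assuming that all degrees are small at the start, only upper bounds on
  degrees are carried along, and each single shift is shown not to break them. The gap is direct for
  a pair of families of equal uniformity. One intersecting family is reduced to it in two stages: a
  vertex that has just become heavy splits the family into its link and the rest, and a second such
  split of this unequal pair leaves two families of uniformity \<open>k - 1\<close>. Each split
  removes one point, and the binomials are stated so that \<open>u\<close> is the same number at
  every stage. The constants add up backwards: \<open>5\<close> for the equal pair;
  \<open>8 = 3 + 5\<close> for a degree bound; \<open>18 = 2 * 8 + 1 + 1\<close> for a shifted
  intersecting family; \<open>34 = 16 + 18\<close>, where \<open>16\<close> is a doubled degree; and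
  \<open>42\<close> exceeds \<open>34\<close>. Finally \<open>(k - 2) * w = (n - 3) * u\<close> with
  \<open>w = (n - 3) choose (k - 2)\<close>, so the hypothesis on \<open>n\<close> turns the claimed
  bound into at least \<open>42 * u\<close>.\<close>

definition ksets :: "nat set \<Rightarrow> nat \<Rightarrow> nat set set" where
  "ksets X k = {S. S \<subseteq> X \<and> card S = k}"

definition without :: "nat set set \<Rightarrow> nat \<Rightarrow> nat set set" where
  "without A e = {S \<in> A. e \<notin> S}"

definition t_cross :: "nat \<Rightarrow> nat set set \<Rightarrow> nat set set \<Rightarrow> bool" where
  "t_cross t A B \<longleftrightarrow> (\<forall>S\<in>A. \<forall>T\<in>B. t \<le> card (S \<inter> T))"

definition cross :: "nat set set \<Rightarrow> nat set set \<Rightarrow> bool" where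
  "cross A B \<longleftrightarrow> (\<forall>S\<in>A. \<forall>T\<in>B. S \<inter> T \<noteq> {})"

definition swap :: "nat \<Rightarrow> nat \<Rightarrow> nat set \<Rightarrow> nat set" where
  "swap i j S = insert i (S - {j})"

definition shifted :: "nat set \<Rightarrow> nat set set \<Rightarrow> bool" where
  "shifted X A \<longleftrightarrow> (\<forall>S\<in>A. \<forall>i\<in>X. \<forall>j\<in>S. i < j \<longrightarrow> i \<notin> S \<longrightarrow> swap i j S \<in> A)"

definition movable :: "nat \<Rightarrow> nat \<Rightarrow> nat set set \<Rightarrow> nat set \<Rightarrow> bool" where
  "movable i j A S \<longleftrightarrow> j \<in> S \<and> i \<notin> S \<and> swap i j S \<notin> A"

definition shift_fun :: "nat \<Rightarrow> nat \<Rightarrow> nat set set \<Rightarrow> nat set \<Rightarrow> nat set" where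
  "shift_fun i j A S = (if movable i j A S then swap i j S else S)"

definition shift :: "nat \<Rightarrow> nat \<Rightarrow> nat set set \<Rightarrow> nat set set" where
  "shift i j A = shift_fun i j A ` A"

lemma ksets_finite: "finite X \<Longrightarrow> finite (ksets X k)"
  unfolding ksets_def by (rule finite_subset[of _ "Pow X"]) auto

lemma card_ksets: "finite X \<Longrightarrow> card (ksets X k) = card X choose k"
  unfolding ksets_def by (rule n_subsets)

lemma ksets_sub_finite: "finite X \<Longrightarrow> A \<subseteq> ksets X k \<Longrightarrow> finite A"
  using finite_subset ksets_finite by blast

lemma card_ksets_sub: "finite X \<Longrightarrow> A \<subseteq> ksets X k \<Longrightarrow> card A \<le> card X choose k"
  using card_mono[OF ksets_finite] card_ksets by metis

lemma link_eq: "link A e = (\<lambda>S. S - {e}) ` {S \<in> A. e \<in> S}"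
  unfolding link_def by auto

lemma inj_on_minus_superset: "inj_on (\<lambda>S. S - E) {S. E \<subseteq> S}"
  by (rule inj_onI) (blast)

lemma card_link: "card (link A e) = card {S \<in> A. e \<in> S}"
  unfolding link_eq by (rule card_image) (rule inj_on_subset[OF inj_on_minus_superset], auto)

lemma card_link_without:
  assumes "finite A" shows "card A = card (link A e) + card (without A e)"
proof -
  have "A = {S \<in> A. e \<in> S} \<union> without A e" by (auto simp: without_def)
  moreover have "card ({S \<in> A. e \<in> S} \<union> without A e) = card {S \<in> A. e \<in> S} + card (without A e)"
    by (rule card_Un_disjoint) (use assms in \<open>auto simp: without_def\<close>)
  ultimately show ?thesis by (simp add: card_link)
qed

lemma without_ksets: "A \<subseteq> ksets X k \<Longrightarrow> without A e \<subseteq> ksets (X - {e}) k"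
  by (auto simp: without_def ksets_def)

lemma link_ksets:
  assumes "A \<subseteq> ksets X k" shows "link A e \<subseteq> ksets (X - {e}) (k - 1)"
proof
  fix S assume "S \<in> link A e"
  then obtain T where T: "T \<in> A" "e \<in> T" "S = T - {e}" by (auto simp: link_def)
  then have "T \<subseteq> X" "card T = k" using assms by (auto simp: ksets_def)
  then show "S \<in> ksets (X - {e}) (k - 1)" using T by (auto simp: ksets_def)
qed

lemma without_mem: "S \<in> without A e \<longleftrightarrow> S \<in> A \<and> e \<notin> S"
  by (auto simp: without_def)

lemma link_mem: "S \<in> link A e \<longleftrightarrow> e \<notin> S \<and> insert e S \<in> A"
proof
  assume "S \<in> link A e" then show "e \<notin> S \<and> insert e S \<in> A"
    by (auto simp: link_def insert_absorb)
next
  assume "e \<notin> S \<and> insert e S \<in> A"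
  then have "insert e S - {e} = S" "insert e S \<in> A" by auto
  then show "S \<in> link A e" unfolding link_def by blast
qed

lemma swap_link: "i \<noteq> e \<Longrightarrow> j \<noteq> e \<Longrightarrow> swap i j (insert e S) = insert e (swap i j S)"
  by (auto simp: swap_def)

lemma shifted_without: "shifted X A \<Longrightarrow> shifted (X - {e}) (without A e)"
  by (auto simp: shifted_def without_def swap_def)

lemma shifted_link: "shifted X A \<Longrightarrow> shifted (X - {e}) (link A e)"
  unfolding shifted_def Ball_def link_mem
proof (intro allI impI)
  fix S i j
  assume sh: "\<forall>S. S \<in> A \<longrightarrow> (\<forall>i. i \<in> X \<longrightarrow> (\<forall>j. j \<in> S \<longrightarrow> i < j \<longrightarrow> i \<notin> S \<longrightarrow> swap i j S \<in> A))"
    and S: "e \<notin> S \<and> insert e S \<in> A" and i: "i \<in> X - {e}" and j: "j \<in> S" "i < j" "i \<notin> S"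
  then have "swap i j (insert e S) \<in> A" by auto
  moreover have "j \<noteq> e" using S j by auto
  ultimately show "e \<notin> swap i j S \<and> insert e (swap i j S) \<in> A"
    using S i by (auto simp: swap_link) (auto simp: swap_def)
qed

lemma shiftedD:
  "shifted X A \<Longrightarrow> S \<in> A \<Longrightarrow> i \<in> X \<Longrightarrow> j \<in> S \<Longrightarrow> i < j \<Longrightarrow> i \<notin> S \<Longrightarrow> swap i j S \<in> A"
  by (simp add: shifted_def)

lemma shift_cases:
  assumes "S \<in> shift i j A"
  obtains "S \<in> A" "\<not> movable i j A S"
  | T where "T \<in> A" "movable i j A T" "S = swap i j T"
  using assms unfolding shift_def shift_fun_def by (auto split: if_splits)

lemma swap_swap: "j \<in> S \<Longrightarrow> i \<notin> S \<Longrightarrow> swap j i (swap i j S) = S"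
  by (auto simp: swap_def)

text \<open>A moved set lands outside \<open>A\<close>, so it cannot collide with a set that stays;
  two moved sets are recovered from their images by the reverse swap.\<close>

lemma shift_fun_inj: "inj_on (shift_fun i j A) A"
proof (rule inj_onI)
  fix S T assume ST: "S \<in> A" "T \<in> A" "shift_fun i j A S = shift_fun i j A T"
  show "S = T"
  proof (cases "movable i j A S \<and> movable i j A T")
    case True
    then show ?thesis using ST swap_swap by (metis movable_def shift_fun_def)
  next
    case False
    then show ?thesis using ST by (auto simp: shift_fun_def movable_def split: if_splits)
  qed
qed

lemma card_shift: "card (shift i j A) = card A"
  unfolding shift_def by (rule card_image[OF shift_fun_inj])

lemma card_swap: "finite S \<Longrightarrow> j \<in> S \<Longrightarrow> i \<notin> S \<Longrightarrow> card (swap i j S) = card S"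
  by (metis DiffE card.remove card_insert_disjoint finite_Diff swap_def)

lemma shift_ksets:
  assumes "finite X" "i \<in> X" "A \<subseteq> ksets X k" shows "shift i j A \<subseteq> ksets X k"
proof
  fix S assume "S \<in> shift i j A"
  then show "S \<in> ksets X k"
  proof (cases rule: shift_cases)
    case 1 then show ?thesis using assms by auto
  next
    case (2 T)
    then have "T \<subseteq> X" "card T = k" using assms by (auto simp: ksets_def)
    moreover have "finite T" using \<open>T \<subseteq> X\<close> assms(1) by (rule finite_subset)
    ultimately show ?thesis using 2 assms card_swap[of T j i]
      by (auto simp: ksets_def movable_def swap_def)
  qed
qed

text \<open>Two moved sets share \<open>i\<close>. If only \<open>T'\<close> moves and
  \<open>j\<close> was the only point it shared with \<open>S\<close>, then either \<open>i\<close>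
  is in \<open>S\<close>, or \<open>S\<close> stayed because its own swap is already in the family;
  that swap meets \<open>T'\<close> away from \<open>i\<close> and \<open>j\<close>, and so does
  \<open>S\<close>.\<close>

lemma shift_cross:
  assumes "cross A B" shows "cross (shift i j A) (shift i j B)"
  unfolding cross_def
proof (intro ballI)
  fix S T assume S: "S \<in> shift i j A" and T: "T \<in> shift i j B"
  have c: "\<And>S T. S \<in> A \<Longrightarrow> T \<in> B \<Longrightarrow> \<exists>x. x \<in> S \<and> x \<in> T" using assms by (auto simp: cross_def)
  have "\<exists>x. x \<in> S \<and> x \<in> T"
    using S
  proof (cases rule: shift_cases)
    case S1: 1
    show ?thesis using T
    proof (cases rule: shift_cases)
      case 1 then show ?thesis using S1 c by blast
    next
      case (2 T')
      have "j \<in> S \<Longrightarrow> i \<notin> S \<Longrightarrow> swap i j S \<in> A" using S1 by (auto simp: movable_def)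
      then show ?thesis using c[of S T'] c[of "swap i j S" T'] S1 2
        by (auto simp: movable_def swap_def) 
    qed
  next
    case S2: (2 S')
    show ?thesis using T
    proof (cases rule: shift_cases)
      case 1
      have "j \<in> T \<Longrightarrow> i \<notin> T \<Longrightarrow> swap i j T \<in> B" using 1 by (auto simp: movable_def)
      then show ?thesis using c[of S' T] c[of S' "swap i j T"] 1 S2
        by (auto simp: movable_def swap_def) 
    next
      case (2 T')
      then show ?thesis using S2 by (auto simp: swap_def)
    qed
  qed
  then show "S \<inter> T \<noteq> {}" by blast
qed

lemma shift_fun_mem: "e \<noteq> i \<Longrightarrow> e \<noteq> j \<Longrightarrow> e \<in> shift_fun i j A S \<longleftrightarrow> e \<in> S"
  by (auto simp: shift_fun_def swap_def)

lemma shift_degree_other: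
  assumes "e \<noteq> i" "e \<noteq> j" shows "card (link (shift i j A) e) = card (link A e)"
proof -
  have "{S \<in> shift i j A. e \<in> S} = shift_fun i j A ` {S \<in> A. e \<in> S}"
    using assms by (auto simp: shift_def shift_fun_mem)
  moreover have "card (shift_fun i j A ` {S \<in> A. e \<in> S}) = card {S \<in> A. e \<in> S}"
    by (rule card_image) (rule inj_on_subset[OF shift_fun_inj], auto)
  ultimately show ?thesis by (simp add: card_link)
qed

lemma shift_degree_down:
  assumes "finite A" "i \<noteq> j" shows "card (link (shift i j A) j) \<le> card (link A j)"
proof -
  have "{S \<in> shift i j A. j \<in> S} \<subseteq> {S \<in> A. j \<in> S}"
    using assms by (auto simp: shift_def shift_fun_def swap_def split: if_splits)
  then show ?thesis unfolding card_link using assms by (intro card_mono) auto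
qed

text \<open>Sets through \<open>i\<close> after the shift come from sets through \<open>i\<close> or
  \<open>j\<close>. Since no other vertex gains, a common bound on all degrees at most doubles, and
  only at \<open>i\<close>.\<close>

lemma shift_degree_up:
  assumes "finite A"
  shows "card (link (shift i j A) i) \<le> card (link A i) + card (link A j)"
proof -
  have "{S \<in> shift i j A. i \<in> S} \<subseteq> shift_fun i j A ` ({S \<in> A. i \<in> S} \<union> {S \<in> A. j \<in> S})"
    by (auto simp: shift_def shift_fun_def movable_def split: if_splits)
  then have "card {S \<in> shift i j A. i \<in> S} \<le> card ({S \<in> A. i \<in> S} \<union> {S \<in> A. j \<in> S})"
    using assms by (intro surj_card_le) auto
  also have "\<dots> \<le> card {S \<in> A. i \<in> S} + card {S \<in> A. j \<in> S}" by (rule card_Un_le)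
  finally show ?thesis by (simp add: card_link)
qed

section \<open>Termination of the shifting process\<close>

definition weight :: "nat set set \<Rightarrow> nat" where "weight A = (\<Sum>S\<in>A. \<Sum>S)"

lemma sum_swap: "finite S \<Longrightarrow> j \<in> S \<Longrightarrow> i \<notin> S \<Longrightarrow> \<Sum>(swap i j S) + j = \<Sum>S + i"
  by (simp add: swap_def sum.remove[of S j])

lemma weight_shift_eq: "weight (shift i j A) = (\<Sum>S\<in>A. \<Sum>(shift_fun i j A S))"
  unfolding weight_def shift_def by (subst sum.reindex[OF shift_fun_inj]) simp

lemma finite_member: "finite X \<Longrightarrow> A \<subseteq> Pow X \<Longrightarrow> S \<in> A \<Longrightarrow> finite S"
  by (meson PowD finite_subset subsetD)

lemma shift_fun_sum_le:
  assumes "finite S" "i < j" shows "\<Sum>(shift_fun i j A S) \<le> \<Sum>S"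
  using sum_swap[of S j i] assms by (auto simp: shift_fun_def movable_def)

lemma weight_shift_le:
  assumes "finite X" "A \<subseteq> Pow X" "i < j" shows "weight (shift i j A) \<le> weight A"
  unfolding weight_shift_eq unfolding weight_def
  by (intro sum_mono shift_fun_sum_le assms(3) finite_member[OF assms(1,2)])

lemma weight_shift_less:
  assumes "finite X" "A \<subseteq> Pow X" "i < j" "S \<in> A" "movable i j A S"
  shows "weight (shift i j A) < weight A"
  unfolding weight_shift_eq unfolding weight_def
proof (rule sum_strict_mono_ex1)
  show "finite A" using assms finite_subset[of A "Pow X"] by auto
  show "\<forall>x\<in>A. \<Sum>(shift_fun i j A x) \<le> \<Sum>x"
    by (intro ballI shift_fun_sum_le assms(3) finite_member[OF assms(1,2)])
  have "finite S" by (rule finite_member[OF assms(1,2,4)])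
  then show "\<exists>a\<in>A. \<Sum>(shift_fun i j A a) < \<Sum>a"
    using assms sum_swap[of S j i] by (intro bexI[of _ S]) (auto simp: shift_fun_def movable_def)
qed

text \<open>Both families undergo the same shifts, as \<open>shift_cross\<close> demands, and the
  total of all their elements strictly drops as long as one of them is not shifted. The invariant
  \<open>I\<close> is left open so that degree bounds can be carried along.\<close>

lemma shifted_exists:
  assumes "finite X" "I A B"
    and sub: "\<And>A B. I A B \<Longrightarrow> A \<subseteq> Pow X \<and> B \<subseteq> Pow X"
    and step: "\<And>A B i j. I A B \<Longrightarrow> i \<in> X \<Longrightarrow> j \<in> X \<Longrightarrow> i < j \<Longrightarrow> I (shift i j A) (shift i j B)"
  shows "\<exists>A' B'. I A' B' \<and> shifted X A' \<and> shifted X B'"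
  using \<open>I A B\<close>
proof (induction "weight A + weight B" arbitrary: A B rule: less_induct)
  case less
  have AB: "A \<subseteq> Pow X" "B \<subseteq> Pow X" using sub[OF less.prems] by auto
  show ?case
  proof (cases "shifted X A \<and> shifted X B")
    case True then show ?thesis using less.prems by blast
  next
    case False
    then obtain i j S where ij: "i \<in> X" "i < j" "j \<in> S" "i \<notin> S"
      "S \<in> A \<and> swap i j S \<notin> A \<or> S \<in> B \<and> swap i j S \<notin> B"
      unfolding shifted_def by blast
    then have "j \<in> X" using AB by auto
    have "weight (shift i j A) + weight (shift i j B) < weight A + weight B"
      using ij weight_shift_le[OF assms(1) AB(1) ij(2)] weight_shift_le[OF assms(1) AB(2) ij(2)]
        weight_shift_less[OF assms(1) AB(1) ij(2), of S] weight_shift_less[OF assms(1) AB(2) ij(2), of S]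
      by (auto simp: movable_def)
    then show ?thesis using less.hyps step[OF less.prems \<open>i \<in> X\<close> \<open>j \<in> X\<close> \<open>i < j\<close>] by blast
  qed
qed

section \<open>Bounds for shifted and for cross-intersecting families\<close>

lemma t_cross_small:
  assumes "finite X" "A \<subseteq> ksets X k" "k < t" "t_cross t A B"
  shows "A = {} \<or> B = {}"
proof (rule ccontr)
  assume "\<not> ?thesis"
  then obtain S T where ST: "S \<in> A" "T \<in> B" by blast
  then have "S \<subseteq> X" "card S = k" using assms(2) by (auto simp: ksets_def)
  moreover have "card (S \<inter> T) \<le> card S"
    using \<open>S \<subseteq> X\<close> assms(1) finite_subset by (intro card_mono) blast+
  ultimately show False using ST assms(3,4) unfolding t_cross_def by fastforce
qed

lemma t_crossD: "t_cross t A B \<Longrightarrow> S \<in> A \<Longrightarrow> T \<in> B \<Longrightarrow> t \<le> card (S \<inter> T)"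
  by (simp add: t_cross_def)

lemma t_cross_sym: "t_cross t A B \<Longrightarrow> t_cross t B A"
  unfolding t_cross_def by (metis Int_commute)

lemma t_cross_link_without:
  assumes "t_cross t A B" shows "t_cross t (link A e) (without B e)"
  unfolding t_cross_def
proof (intro ballI)
  fix S T assume S: "S \<in> link A e" and T: "T \<in> without B e"
  then have "t \<le> card (insert e S \<inter> T)"
    by (intro t_crossD[OF assms]) (simp_all add: link_mem without_def)
  moreover have "insert e S \<inter> T = S \<inter> T" using T by (auto simp: without_def)
  ultimately show "t \<le> card (S \<inter> T)" by simp
qed

lemma t_cross_link_link:
  assumes "t_cross t A B" shows "t_cross (t - 1) (link A e) (link B e)"
  unfolding t_cross_def
proof (intro ballI)
  fix S T assume S: "S \<in> link A e" and T: "T \<in> link B e"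
  then have "t \<le> card (insert e S \<inter> insert e T)"
    by (intro t_crossD[OF assms]) (simp_all add: link_mem)
  also have "insert e S \<inter> insert e T = insert e (S \<inter> T)" by auto
  also have "card \<dots> \<le> Suc (card (S \<inter> T))" by (cases "finite (S \<inter> T)") (simp_all add: card_insert_if)
  finally show "t - 1 \<le> card (S \<inter> T)" by simp
qed

text \<open>If \<open>S\<close> and \<open>T\<close> avoid the least element \<open>e\<close> and
  meet in exactly \<open>t\<close> points, replacing a common point by \<open>e\<close> in
  \<open>S\<close> stays inside \<open>A\<close> and leaves only \<open>t - 1\<close> common
  points.\<close>

lemma t_cross_without:
  assumes "finite X" "A \<subseteq> Pow X" "e \<in> X" "\<And>x. x \<in> X \<Longrightarrow> e \<le> x" "shifted X A"
    and "t_cross t A B" "1 \<le> t"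
  shows "t_cross (Suc t) (without A e) (without B e)"
  unfolding t_cross_def
proof (intro ballI, rule ccontr)
  fix S T assume S: "S \<in> without A e" and T: "T \<in> without B e" and "\<not> Suc t \<le> card (S \<inter> T)"
  then have c: "card (S \<inter> T) = t" using assms(6) by (force simp: t_cross_def without_def)
  then obtain j where j: "j \<in> S \<inter> T" using assms(7) by (metis card.empty ex_in_conv not_one_le_zero)
  have "S \<subseteq> X" "e \<notin> S" "S \<in> A" "e \<notin> T" "T \<in> B" using S T assms(2) by (auto simp: without_def)
  then have "swap e j S \<in> A"
    using assms(3-5) j by (force simp: shifted_def order.strict_iff_order)
  then have "t \<le> card (swap e j S \<inter> T)" using assms(6) \<open>T \<in> B\<close> by (simp add: t_cross_def)
  moreover have "swap e j S \<inter> T = (S \<inter> T) - {j}" using \<open>e \<notin> T\<close> by (auto simp: swap_def)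
  moreover have "card ((S \<inter> T) - {j}) = t - 1" using c j by simp
  ultimately show False using assms(7) by simp
qed

text \<open>For \<open>t\<close>-intersecting shifted families the walk argument bounds the size by the number of
  walks that reach height \<open>t\<close>; the recursion on the smallest element turns the reflection principle
  into Pascal's rule, and it applies verbatim to products of cross-intersecting families.\<close>

lemma shifted_product_bound:
  assumes "finite X" "A \<subseteq> ksets X (a + t)" "B \<subseteq> ksets X (b + t)"
    and "shifted X A" "shifted X B" "t_cross t A B"
  shows "card A * card B \<le> (card X choose a) * (card X choose b)"
  using assms
proof (induction "card X" arbitrary: X A B a b t)
  case 0
  then have X: "X = {}" by simp
  show ?case
  proof (cases "A = {} \<or> B = {}")
    case True then show ?thesis by auto
  next
    case False
    then obtain S T where "S \<in> A" "T \<in> B" by blast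
    then have "a = 0" "b = 0" using "0.prems"(2,3) X by (auto simp: ksets_def)
    moreover have "card A \<le> 1" "card B \<le> 1"
      using "0.prems"(2,3) X card_mono[of "{{}}" A] card_mono[of "{{}}" B] by (auto simp: ksets_def)
    ultimately show ?thesis using X mult_le_mono[of "card A" 1 "card B" 1] by simp
  qed
next
  case (Suc n)
  define e where "e = Min X"
  have "X \<noteq> {}" using Suc.hyps(2) by auto
  then have e: "e \<in> X" "\<And>x. x \<in> X \<Longrightarrow> e \<le> x" using Suc.prems(1) by (auto simp: e_def)
  define Y where "Y = X - {e}"
  have Y: "finite Y" "n = card Y" using Suc.hyps(2) Suc.prems(1) e by (auto simp: Y_def)
  have finA: "finite A" "finite B" using Suc.prems ksets_sub_finite by blast+
  let ?A1 = "link A e" and ?A0 = "without A e" and ?B1 = "link B e" and ?B0 = "without B e"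
  have sub: "?A1 \<subseteq> ksets Y (a + t - 1)" "?B1 \<subseteq> ksets Y (b + t - 1)"
      "?A0 \<subseteq> ksets Y (a + t)" "?B0 \<subseteq> ksets Y (b + t)"
    unfolding Y_def using Suc.prems by (intro link_ksets without_ksets; simp)+
  have sh: "shifted Y ?A1" "shifted Y ?B1" "shifted Y ?A0" "shifted Y ?B0"
    unfolding Y_def using Suc.prems by (intro shifted_link shifted_without; simp)+
  show ?case
  proof (cases "t = 0")
    case True
    then show ?thesis using card_ksets_sub[OF Suc.prems(1)] Suc.prems(2,3)
      by (simp add: mult_le_mono)
  next
    case False
    note IH = Suc.hyps(1)[OF Y(2) Y(1)]
    have APow: "A \<subseteq> Pow X" using Suc.prems(2) by (auto simp: ksets_def)
    \<comment> \<open>This is \<open>n choose (x - 1)\<close>, but with value 0 at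
      \<open>x = 0\<close>; truncated subtraction would give 1 there and break Pascal's
      rule.\<close>
    let ?p = "\<lambda>x. case x of 0 \<Rightarrow> 0 | Suc y \<Rightarrow> n choose y"
    have pascal: "\<And>x. Suc n choose x = (n choose x) + ?p x" by (simp split: nat.split)
    \<comment> \<open>In the four products the parameters move as follows. If both sets contain
      \<open>e\<close>, then \<open>t\<close> drops by one and \<open>a\<close>, \<open>b\<close>
      stay; if only one contains it, the parameter of that set drops; if neither does,
      \<open>t\<close> rises by one and both drop. A parameter that is already 0 forces an empty
      family.\<close>
    have 11: "card ?A1 * card ?B1 \<le> (n choose a) * (n choose b)"
      using IH[of ?A1 a "t - 1" ?B1 b] sub sh t_cross_link_link[OF Suc.prems(6)] False Y by simp
    have 10: "card ?A1 * card ?B0 \<le> ?p a * (n choose b)"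
    proof (cases a)
      case 0
      then have "?A1 = {} \<or> ?B0 = {}"
        using t_cross_small[OF Y(1) sub(1) _ t_cross_link_without[OF Suc.prems(6)]] False by simp
      then show ?thesis by auto
    next
      case (Suc a')
      then show ?thesis
        using IH[of ?A1 a' t ?B0 b] sub sh t_cross_link_without[OF Suc.prems(6)] Y by simp
    qed
    have 01: "card ?A0 * card ?B1 \<le> (n choose a) * ?p b"
    proof (cases b)
      case 0
      then have "?B1 = {} \<or> ?A0 = {}"
        using t_cross_small[OF Y(1) sub(2) _ t_cross_link_without[OF t_cross_sym[OF Suc.prems(6)]]] False
        by simp
      then show ?thesis by auto
    next
      case (Suc b')
      then show ?thesis
        using IH[of ?A0 a t ?B1 b'] sub sh t_cross_sym[OF t_cross_link_without[OF t_cross_sym[OF Suc.prems(6)]]] Y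
        by simp
    qed
    have t00: "t_cross (Suc t) ?A0 ?B0"
      using t_cross_without[OF Suc.prems(1) APow e Suc.prems(4,6)] False by simp
    have 00: "card ?A0 * card ?B0 \<le> ?p a * ?p b"
    proof (cases "a = 0 \<or> b = 0")
      case True
      then have "?A0 = {} \<or> ?B0 = {}"
        using t_cross_small[OF Y(1) sub(3) _ t00] t_cross_small[OF Y(1) sub(4) _ t_cross_sym[OF t00]]
        by auto
      then show ?thesis by auto
    next
      case False
      then obtain a' b' where "a = Suc a'" "b = Suc b'" by (metis not0_implies_Suc)
      then show ?thesis
        using IH[of ?A0 a' "Suc t" ?B0 b'] sub sh t00 Y by simp
    qed
    have "card A * card B = (card ?A1 + card ?A0) * (card ?B1 + card ?B0)"
      using card_link_without[OF finA(1), of e] card_link_without[OF finA(2), of e] by simp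
    also have "\<dots> = card ?A1 * card ?B1 + card ?A1 * card ?B0 + card ?A0 * card ?B1 + card ?A0 * card ?B0"
      by (simp add: algebra_simps)
    also have "\<dots> \<le> (n choose a) * (n choose b) + ?p a * (n choose b) + (n choose a) * ?p b + ?p a * ?p b"
      using 11 10 01 00 by linarith
    also have "\<dots> = (Suc n choose a) * (Suc n choose b)"
      unfolding pascal by (simp only: algebra_simps)
    finally show ?thesis using Suc.hyps(2) by simp
  qed
qed

section \<open>Cross-intersecting families and Kruskal--Katona\<close>

lemma cross_sym: "cross A B \<Longrightarrow> cross B A"
  by (auto simp: cross_def)

lemma cross_t_cross:
  assumes "finite X" "A \<subseteq> Pow X" "cross A B" shows "t_cross 1 A B"
  unfolding t_cross_def
proof (intro ballI)
  fix S T assume ST: "S \<in> A" "T \<in> B"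
  then have "S \<inter> T \<noteq> {}" using assms(3) by (auto simp: cross_def)
  moreover have "finite (S \<inter> T)" using finite_member[OF assms(1,2)] ST by blast
  ultimately show "1 \<le> card (S \<inter> T)" by (simp add: Suc_le_eq card_gt_0_iff)
qed

lemma cross_without_without: "cross A B \<Longrightarrow> cross (without A e) (without B e)"
  by (auto simp: cross_def without_def)

lemma cross_link_without: "cross A B \<Longrightarrow> cross (link A e) (without B e)"
  unfolding cross_def Ball_def link_mem without_mem by (metis Int_insert_left_if0)

lemma cross_without_link: "cross A B \<Longrightarrow> cross (without A e) (link B e)"
  using cross_link_without cross_sym by blast

text \<open>If the links had disjoint members \<open>S\<close> and \<open>T\<close>, then
  \<open>a + b \<le> card X\<close> would leave a point \<open>i\<close> outside both and different
  from \<open>e\<close>; shifting \<open>e\<close> to \<open>i\<close> in the first set would make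
  it disjoint from the second.\<close>

lemma cross_link_link_Max:
  assumes "finite X" "A \<subseteq> ksets X a" "B \<subseteq> ksets X b" "a + b \<le> card X"
    and "\<And>x. x \<in> X \<Longrightarrow> x \<le> e" "shifted X A" "cross A B"
  shows "cross (link A e) (link B e)"
  unfolding cross_def
proof (intro ballI notI)
  fix S T assume S: "S \<in> link A e" and T: "T \<in> link B e" and ST: "S \<inter> T = {}"
  have S': "e \<notin> S" "insert e S \<in> A" and T': "e \<notin> T" "insert e T \<in> B" using S T by (auto simp: link_mem)
  have SX: "insert e S \<subseteq> X" "card (insert e S) = a" "insert e T \<subseteq> X" "card (insert e T) = b"
    using S' T' assms(2,3) by (auto simp: ksets_def)
  then have fin: "finite S" "finite T" using assms(1) finite_subset by (metis finite_insert)+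
  have "card (insert e (S \<union> T)) < card X"
    using SX S' T' fin ST assms(4) by (simp add: card_Un_disjoint)
  moreover have "insert e (S \<union> T) \<subseteq> X" using SX by auto
  ultimately obtain i where i: "i \<in> X" "i \<notin> insert e (S \<union> T)"
    by (metis subsetI subset_antisym less_irrefl)
  then have "i < e" using assms(5)[of i] by (simp add: order.strict_iff_order)
  then have "swap i e (insert e S) \<in> A"
    using assms(6) S' i unfolding shifted_def by blast
  moreover have "swap i e (insert e S) \<inter> insert e T = {}"
    using S' T' i ST by (auto simp: swap_def)
  ultimately show False using assms(7) T' unfolding cross_def by blast
qed

text \<open>The extremal pair behind the numbers: \<open>B\<close> consists of all
  \<open>b\<close>-sets containing a fixed \<open>t\<close>-set, and \<open>A\<close> of all
  \<open>a\<close>-sets meeting it. The induction removes the largest element, where all four pairs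
  of halves stay cross-intersecting.\<close>

lemma shifted_cross_bound:
  assumes "finite X" "A \<subseteq> ksets X a" "B \<subseteq> ksets X b" "shifted X A" "shifted X B" "cross A B"
    and "a + b \<le> card X" "t \<le> b" "(card X - t) choose (b - t) \<le> card B"
  shows "card A + ((card X - t) choose a) \<le> card X choose a"
  using assms
proof (induction "card X" arbitrary: X A B a b rule: less_induct)
  case less
  have finAB: "finite A" "finite B" using less.prems ksets_sub_finite by blast+
  have "0 < (card X - t) choose (b - t)" using less.prems(7,8) by (simp add: zero_less_binomial)
  then have "B \<noteq> {}" using less.prems(9) by auto
  then obtain T where T: "T \<in> B" by auto
  then have TX: "T \<subseteq> X" "card T = b"
    using less.prems(3) by (auto simp: ksets_def)
  then have "finite T" using less.prems(1) finite_subset by blast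
  \<comment> \<open>The first three cases are the boundary of the induction: when
    \<open>t = b\<close>, one member of \<open>B\<close> suffices; when
    \<open>a + b = card X\<close>, the complements of \<open>B\<close> are \<open>a\<close>-sets
    outside \<open>A\<close>. The strict inequalities of the last case keep the hypotheses valid on
    one point less.\<close>
  consider "a = 0" | "t = b" | "a + b = card X" | "0 < a" "t < b" "a + b < card X"
    using less.prems(7,8) by linarith
  then show ?case
  proof cases
    case 1
    have "A = {}"
    proof (rule ccontr)
      assume "A \<noteq> {}"
      then obtain S where "S \<in> A" by blast
      then have "S \<subseteq> X" "card S = 0" using less.prems(2) 1 by (auto simp: ksets_def)
      then have "S = {}" using less.prems(1) finite_subset by (metis card_0_eq)
      then show False using \<open>S \<in> A\<close> T less.prems(6) by (auto simp: cross_def)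
    qed
    then show ?thesis using 1 by simp
  next
    case 2
    have "A \<inter> ksets (X - T) a = {}" using less.prems(6) T by (auto simp: cross_def ksets_def)
    moreover have "A \<union> ksets (X - T) a \<subseteq> ksets X a" using less.prems(2) by (auto simp: ksets_def)
    moreover have "finite (ksets (X - T) a)" using less.prems(1) by (intro ksets_finite) simp
    moreover have "card (X - T) = card X - t" using TX 2 \<open>finite T\<close> by (simp add: card_Diff_subset)
    ultimately show ?thesis
      using card_Un_disjoint[of A "ksets (X - T) a"] card_ksets[of "X - T" a] finAB less.prems(1)
        card_ksets_sub[OF less.prems(1), of "A \<union> ksets (X - T) a" a] by simp
  next
    case 3
    let ?C = "(\<lambda>S. X - S) ` B"
    have "?C \<subseteq> ksets X a"
    proof
      fix U assume "U \<in> ?C"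
      then obtain S where S: "S \<in> B" "U = X - S" by auto
      then have "S \<subseteq> X" "card S = b" using less.prems(3) by (auto simp: ksets_def)
      moreover have "finite S" using \<open>S \<subseteq> X\<close> less.prems(1) by (rule finite_subset)
      ultimately show "U \<in> ksets X a" using S 3
        by (auto simp: ksets_def card_Diff_subset)
    qed
    moreover have "A \<inter> ?C = {}" using less.prems(6) by (auto simp: cross_def)
    moreover have "card ?C = card B"
    proof (rule card_image, rule inj_onI)
      fix S S' assume "S \<in> B" "S' \<in> B" "X - S = X - S'"
      moreover have "S \<subseteq> X" "S' \<subseteq> X" using calculation less.prems(3) by (auto simp: ksets_def)
      ultimately show "S = S'" by blast
    qed
    moreover have "finite ?C" using finAB by simp
    ultimately have "card A + card B \<le> card X choose a"
      using card_Un_disjoint[of A ?C] card_ksets_sub[OF less.prems(1), of "A \<union> ?C" a] less.prems(2) finAB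
      by simp
    moreover have "(card X - t) choose a = (card X - t) choose (b - t)"
    proof -
      have "card X - t - (b - t) = a" using 3 less.prems(8) by simp
      then show ?thesis using binomial_symmetric[of "b - t" "card X - t"] 3 less.prems(8) by simp
    qed
    ultimately show ?thesis using less.prems(9) by simp
  next
    case 4
    define e where "e = Max X"
    have "X \<noteq> {}" using 4 by auto
    then have e: "e \<in> X" "\<And>x. x \<in> X \<Longrightarrow> x \<le> e" using less.prems(1) by (auto simp: e_def)
    define Y where "Y = X - {e}"
    obtain m where m: "card X = Suc m" using 4 by (metis not0_implies_Suc not_less_zero)
    have Y: "finite Y" "card Y = m" using m less.prems(1) e by (auto simp: Y_def)
    let ?A1 = "link A e" and ?A0 = "without A e" and ?B1 = "link B e" and ?B0 = "without B e"
    have sub: "?A1 \<subseteq> ksets Y (a - 1)" "?B1 \<subseteq> ksets Y (b - 1)" "?A0 \<subseteq> ksets Y a" "?B0 \<subseteq> ksets Y b"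
      unfolding Y_def using less.prems by (intro link_ksets without_ksets; simp)+
    have sh: "shifted Y ?A1" "shifted Y ?B1" "shifted Y ?A0" "shifted Y ?B0"
      unfolding Y_def using less.prems by (intro shifted_link shifted_without; simp)+
    have cr: "cross ?A1 ?B0" "cross ?A0 ?B0" "cross ?A0 ?B1" "cross ?A1 ?B1"
      using less.prems(6) cross_link_without cross_without_without cross_without_link
        cross_link_link_Max[OF less.prems(1-3,7) e(2) less.prems(4,6)] by auto
    have small: "card Y < card X" using Y m by simp
    obtain a' where a': "a = Suc a'" using 4 by (metis not0_implies_Suc not_less_zero)
    have tm: "t \<le> m" using 4 m by linarith
    have bt: "b - t = Suc (b - 1 - t)" using 4 by linarith
    have "(Suc m - t) choose (b - t) = ((m - t) choose (b - 1 - t)) + ((m - t) choose (b - t))"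
      using tm bt by (simp add: Suc_diff_le)
    then have "((m - t) choose (b - 1 - t)) + ((m - t) choose (b - t)) \<le> card ?B1 + card ?B0"
      using less.prems(9) m card_link_without[OF finAB(2), of e] by simp
    \<comment> \<open>By Pascal's rule one half of \<open>B\<close> reaches its own threshold. That
      single half is then played against both halves of \<open>A\<close>.\<close>
    then consider "(m - t) choose (b - t) \<le> card ?B0" | "(m - t) choose (b - 1 - t) \<le> card ?B1"
      by linarith
    then have "card ?A1 + ((m - t) choose a') \<le> m choose a' \<and> card ?A0 + ((m - t) choose a) \<le> m choose a"
    proof cases
      case 1
      then show ?thesis
        using less.hyps[OF small Y(1) sub(1) sub(4) sh(1,4) cr(1)]
          less.hyps[OF small Y(1) sub(3) sub(4) sh(3,4) cr(2)] 4 Y m a' by simp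
    next
      case 2
      then show ?thesis
        using less.hyps[OF small Y(1) sub(1) sub(2) sh(1,2) cr(4)]
          less.hyps[OF small Y(1) sub(3) sub(2) sh(3,2) cr(3)] 4 Y m a' by simp
    qed
    moreover have "(Suc m - t) choose a = ((m - t) choose a') + ((m - t) choose a)"
      using tm a' by (simp add: Suc_diff_le)
    ultimately show ?thesis using card_link_without[OF finAB(1), of e] m a' by simp
  qed
qed

lemma ksets_Pow: "A \<subseteq> ksets X k \<Longrightarrow> A \<subseteq> Pow X"
  by (auto simp: ksets_def)

text \<open>The Kruskal--Katona theorem at integral arguments, in cross-intersecting form.\<close>

lemma cross_bound:
  assumes "finite X" "A \<subseteq> ksets X a" "B \<subseteq> ksets X b" "cross A B"
    and "a + b \<le> card X" "t \<le> b" "(card X - t) choose (b - t) \<le> card B"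
  shows "card A + ((card X - t) choose a) \<le> card X choose a"
proof -
  define I where "I P Q \<longleftrightarrow> P \<subseteq> ksets X a \<and> Q \<subseteq> ksets X b \<and> cross P Q \<and>
    card P = card A \<and> card Q = card B" for P Q
  have "I A B" using assms by (simp add: I_def)
  have sub: "P \<subseteq> Pow X \<and> Q \<subseteq> Pow X" if "I P Q" for P Q
    using that ksets_Pow unfolding I_def by blast
  have step: "I (shift i j P) (shift i j Q)" if "I P Q" "i \<in> X" for P Q i j
    using that assms(1) by (simp add: I_def card_shift shift_cross shift_ksets)
  obtain A' B' where I: "I A' B'" and sh: "shifted X A'" "shifted X B'"
    using shifted_exists[of X I A B] assms(1) \<open>I A B\<close> sub step by meson
  have AB: "A' \<subseteq> ksets X a" "B' \<subseteq> ksets X b" "cross A' B'" "card A' = card A" "card B' = card B"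
    using I by (simp_all add: I_def)
  show ?thesis
    using shifted_cross_bound[OF assms(1) AB(1,2) sh AB(3) assms(5,6)] assms(7) AB(4,5) by simp
qed

section \<open>Vertices of large degree\<close>

text \<open>Union bound: an \<open>a\<close>-set meeting a fixed \<open>t\<close>-set contains one
  of its \<open>t\<close> points.\<close>

lemma choose_diff_le:
  assumes "t \<le> m" "0 < a"
  shows "m choose a \<le> ((m - t) choose a) + t * ((m - 1) choose (a - 1))"
  using assms(1)
proof (induction t)
  case 0 then show ?case by simp
next
  case (Suc t)
  then have "m - t = Suc (m - Suc t)" by simp
  then have "(m - t) choose a = ((m - Suc t) choose (a - 1)) + ((m - Suc t) choose a)"
    using choose_reduce_nat[of "m - t" a] assms(2) by simp
  moreover have "(m - Suc t) choose (a - 1) \<le> (m - 1) choose (a - 1)"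
    by (rule binomial_right_mono) simp
  ultimately show ?case using Suc by simp
qed

text \<open>Contrapositive of \<open>cross_bound\<close>, with the number of \<open>a\<close>-sets
  meeting a \<open>t\<close>-set replaced by the union bound. Large \<open>A\<close> thus forces
  small \<open>B\<close> with \<open>t\<close> as the exchange rate.\<close>

lemma cross_star_bound:
  assumes "finite X" "A \<subseteq> ksets X a" "B \<subseteq> ksets X b" "cross A B"
    and "a + b \<le> card X" "t \<le> b" "0 < a" "(card X - 1) choose (a - 1) \<le> u" "t * u < card A"
  shows "card B < (card X - t) choose (b - t)"
proof (rule ccontr)
  assume "\<not> ?thesis"
  then have "card A + ((card X - t) choose a) \<le> card X choose a"
    using cross_bound[OF assms(1-6)] by simp
  also have "\<dots> \<le> ((card X - t) choose a) + t * ((card X - 1) choose (a - 1))"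
    using assms by (intro choose_diff_le) auto
  finally have "card A \<le> t * ((card X - 1) choose (a - 1))" by simp
  also have "\<dots> \<le> t * u" using assms(8) by simp
  finally show False using assms(9) by simp
qed

lemma link_without_degree: "finite A \<Longrightarrow> card (link (without A e) w) \<le> card (link A w)"
  unfolding card_link by (intro card_mono) (auto simp: without_def)

lemma link_without_same [simp]: "link (without A e) e = {}"
  by (auto simp: link_def without_def)

lemma degree_outside: "A \<subseteq> Pow X \<Longrightarrow> w \<notin> X \<Longrightarrow> link A w = {}"
  by (auto simp: link_def)

text \<open>The degree of every vertex in a pair of large cross-intersecting families is either at most
  \<open>2u\<close> or more than \<open>4u\<close>. A single shift at most doubles a degree, so this gap keeps
  all degrees small during the whole shifting process, which is absurd at its end.\<close>

lemma cross_center: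
  assumes "finite Y" "P \<subseteq> ksets Y r" "Q \<subseteq> ksets Y r" "cross P Q" "2 \<le> r" "2 * r \<le> card Y"
    and u: "u = (card Y - 1) choose (r - 2)" and large: "5 * u \<le> card P" "5 * u \<le> card Q"
  obtains a where "a \<in> Y" "card (without P a) < u" "card (without Q a) < u"
proof -
  define I where "I A B \<longleftrightarrow> A \<subseteq> ksets Y r \<and> B \<subseteq> ksets Y r \<and> cross A B \<and>
    card A = card P \<and> card B = card Q" for A B
  have gap: "a \<in> Y \<and> card (without B a) < u \<and> 4 * u < card (link B a)"
    if AB: "A \<subseteq> ksets Y r" "B \<subseteq> ksets Y r" "cross A B" "5 * u \<le> card B" and a: "2 * u < card (link A a)"
    for A B a
  proof -
    have "link A a \<noteq> {}" using a by auto
    then have aY: "a \<in> Y" using degree_outside[OF ksets_Pow[OF AB(1)], of a] by auto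
    then have Y': "card (Y - {a}) = card Y - 1" using assms(1) by simp
    have "card (without B a) < (card (Y - {a}) - 2) choose (r - 2)"
    proof (rule cross_star_bound[OF _ link_ksets[OF AB(1)] without_ksets[OF AB(2)]
            cross_link_without[OF AB(3)]])
      show "(card (Y - {a}) - 1) choose (r - 1 - 1) \<le> u"
        unfolding u Y' using assms(5) by (simp add: numeral_2_eq_2 binomial_right_mono)
      show "r - 1 + r \<le> card (Y - {a})" using assms(5,6) Y' by linarith
    qed (use assms a Y' in auto)
    also have "\<dots> \<le> u" unfolding u by (rule binomial_right_mono) (simp add: Y')
    finally have "card (without B a) < u" .
    moreover have "card B = card (link B a) + card (without B a)"
      by (rule card_link_without[OF ksets_sub_finite[OF assms(1) AB(2)]])
    ultimately show ?thesis using AB(4) aY by simp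
  qed
  \<comment> \<open>The gap is applied twice: a heavy vertex of one family is very heavy in the
    other, and then also in the first. Hence degrees strictly between these ranges do not
    occur.\<close>
  have gap2: "a \<in> Y \<and> 4 * u < card (link B a) \<and> 4 * u < card (link A a)
      \<and> card (without B a) < u \<and> card (without A a) < u"
    if "I A B" "2 * u < card (link A a) \<or> 2 * u < card (link B a)" for A B a
    using that gap[of A B a] gap[of B A a] large cross_sym[of A B] unfolding I_def by auto
  have "\<exists>a. 2 * u < card (link P a) \<or> 2 * u < card (link Q a)"
  proof (rule ccontr)
    assume no: "\<not> ?thesis"
    define J where "J A B \<longleftrightarrow> I A B \<and> (\<forall>w. card (link A w) \<le> 2 * u \<and> card (link B w) \<le> 2 * u)" for A B
    have sub: "A \<subseteq> Pow Y \<and> B \<subseteq> Pow Y" if "J A B" for A B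
      using that ksets_Pow unfolding J_def I_def by blast
    have "J P Q" using no assms by (auto simp: J_def I_def not_less)
    have step: "J (shift i j A) (shift i j B)" if "J A B" "i \<in> Y" "i < j" for A B i j
    proof -
      have fin: "finite A" "finite B"
        using that assms(1) ksets_sub_finite unfolding J_def I_def by blast+
      have I: "I (shift i j A) (shift i j B)"
        using that assms(1) by (simp add: J_def I_def card_shift shift_cross shift_ksets)
      have small: "card (link A w) \<le> 2 * u" "card (link B w) \<le> 2 * u" for w
        using that by (auto simp: J_def)
      have up: "card (link (shift i j A) i) \<le> 4 * u"
        using shift_degree_up[OF fin(1), of i j] small(1)[of i] small(1)[of j] by linarith
      have "card (link (shift i j A) w) \<le> 2 * u \<and> card (link (shift i j B) w) \<le> 2 * u" for w
      proof -
        consider "w = i" | "w = j" | "w \<noteq> i" "w \<noteq> j" by blast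
        then show ?thesis
        proof cases
          case 1
          have "\<not> (2 * u < card (link (shift i j A) i) \<or> 2 * u < card (link (shift i j B) i))"
          proof
            assume "2 * u < card (link (shift i j A) i) \<or> 2 * u < card (link (shift i j B) i)"
            from gap2[OF I this] up show False by linarith
          qed
          then show ?thesis using 1 by simp
        next
          case 2
          have "i \<noteq> j" using that by simp
          then show ?thesis
            using 2 small[of j] shift_degree_down[OF fin(1), of i j] shift_degree_down[OF fin(2), of i j]
            by simp
        next
          case 3 then show ?thesis using small shift_degree_other by simp
        qed
      qed
      then show ?thesis using I by (simp add: J_def)
    qed
    obtain A B where J: "J A B" and sh: "shifted Y A" "shifted Y B"
      using shifted_exists[of Y J P Q] assms(1) \<open>J P Q\<close> sub step by meson
    have AB: "A \<subseteq> ksets Y r" "B \<subseteq> ksets Y r" "cross A B" "card A = card P" "card B = card Q"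
      using J by (auto simp: J_def I_def)
    define e where "e = Min Y"
    have "Y \<noteq> {}" using assms(5,6) by auto
    then have e: "e \<in> Y" "\<And>x. x \<in> Y \<Longrightarrow> e \<le> x" using assms(1) by (auto simp: e_def)
    have "t_cross 2 (without A e) (without B e)"
      using t_cross_without[OF assms(1) _ e sh(1) cross_t_cross[OF assms(1) _ AB(3)]] sub[OF J]
      by (simp add: numeral_2_eq_2)
    moreover have "r = r - 2 + 2" using assms(5) by simp
    ultimately have "card (without A e) * card (without B e) \<le> u * u"
      using shifted_product_bound[of "Y - {e}" "without A e" "r - 2" 2 "without B e" "r - 2"]
        without_ksets[OF AB(1), of e] without_ksets[OF AB(2), of e] sh shifted_without[of Y] assms(1) e
      by (simp add: u)
    \<comment> \<open>One factor of a product bounded by \<open>u * u\<close> is at most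
      \<open>u\<close>; with a degree of at most \<open>2 * u\<close> at \<open>e\<close>, that
      family has at most \<open>3 * u\<close> members instead of \<open>5 * u\<close>.\<close>
    then have "card (without A e) \<le> u \<or> card (without B e) \<le> u"
      using mult_strict_mono[of u "card (without A e)" u "card (without B e)"] by linarith
    moreover have "card A = card (link A e) + card (without A e)"
        "card B = card (link B e) + card (without B e)"
      using card_link_without ksets_sub_finite[OF assms(1)] AB by blast+
    moreover have "card (link A e) \<le> 2 * u" "card (link B e) \<le> 2 * u" using J by (auto simp: J_def)
    moreover have "0 < u" unfolding u using assms(5,6) by (simp add: zero_less_binomial)
    ultimately show False using AB(4,5) large by linarith
  qed
  then obtain a where "2 * u < card (link P a) \<or> 2 * u < card (link Q a)" by blast
  moreover have "I P Q" using assms by (simp add: I_def)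
  ultimately show ?thesis using gap2 that by blast
qed

section \<open>From pairs of families to one intersecting family\<close>

text \<open>Split by the three least elements \<open>e\<close>, \<open>f\<close>, \<open>g\<close>.
  Sets avoiding \<open>e\<close> and \<open>f\<close> pairwise share three points; those with
  \<open>f\<close> but without \<open>e\<close> and \<open>g\<close> still share two points besides
  \<open>f\<close>. Both classes fall under \<open>shifted_product_bound\<close>. What remains
  contains \<open>e\<close>, or contains \<open>f\<close> and \<open>g\<close> but not
  \<open>e\<close>.\<close>

lemma shifted_intersecting_degree:
  assumes "finite X" "Q \<subseteq> ksets X k" "cross Q Q" "shifted X Q" "3 \<le> k" "3 \<le> card X"
  shows "\<exists>e. card Q \<le> 2 * card (link Q e) + ((card X - 2) choose (k - 3)) + ((card X - 3) choose (k - 3))"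
proof -
  define e where "e = Min X"
  define X1 where "X1 = X - {e}"
  define f where "f = Min X1"
  define X2 where "X2 = X1 - {f}"
  define g where "g = Min X2"
  have fin: "finite X1" "finite X2" using assms(1) by (auto simp: X1_def X2_def)
  have "X \<noteq> {}" using assms(6) by auto
  then have e: "e \<in> X" "\<And>x. x \<in> X \<Longrightarrow> e \<le> x" using assms(1) by (auto simp: e_def)
  then have c1: "card X1 = card X - 1" using assms(1) by (simp add: X1_def)
  then have "X1 \<noteq> {}" using assms(6) by auto
  then have f: "f \<in> X1" "\<And>x. x \<in> X1 \<Longrightarrow> f \<le> x" using fin by (auto simp: f_def)
  then have c2: "card X2 = card X - 2" using fin c1 by (simp add: X2_def)
  then have "X2 \<noteq> {}" using assms(6) by auto
  then have g: "g \<in> X2" "\<And>x. x \<in> X2 \<Longrightarrow> g \<le> x" using fin by (auto simp: g_def)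
  have efg: "e \<noteq> f" "e \<noteq> g" "f \<noteq> g" "e < g" using e(2)[of g] f g by (auto simp: X1_def X2_def)
  have pow: "\<And>k X A. A \<subseteq> ksets X k \<Longrightarrow> A \<subseteq> Pow X" by (rule ksets_Pow)
  define Q0 where "Q0 = without Q e"
  define Q00 where "Q00 = without Q0 f"
  define Q01 where "Q01 = link Q0 f"
  define Q010 where "Q010 = without Q01 g"
  have Q0: "Q0 \<subseteq> ksets X1 k" "shifted X1 Q0"
    unfolding Q0_def X1_def using without_ksets[OF assms(2)] shifted_without[OF assms(4)] by auto
  have "t_cross (Suc 1) Q0 Q0"
    unfolding Q0_def
    by (rule t_cross_without[OF assms(1) pow[OF assms(2)] e assms(4) cross_t_cross[OF assms(1) pow[OF assms(2)] assms(3)]]) simp_all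
  then have t0: "t_cross 2 Q0 Q0" by (simp add: numeral_2_eq_2)
  have Q00: "Q00 \<subseteq> ksets X2 k" "shifted X2 Q00"
    unfolding Q00_def X2_def using without_ksets[OF Q0(1)] shifted_without[OF Q0(2)] by auto
  have "t_cross (Suc 2) Q00 Q00"
    unfolding Q00_def by (rule t_cross_without[OF fin(1) pow[OF Q0(1)] f Q0(2) t0]) simp_all
  then have t00: "t_cross 3 Q00 Q00" by (simp add: numeral_3_eq_3)
  have Q01: "Q01 \<subseteq> ksets X2 (k - 1)" "shifted X2 Q01"
    unfolding Q01_def X2_def using link_ksets[OF Q0(1)] shifted_link[OF Q0(2)] by auto
  have t01: "t_cross 1 Q01 Q01"
    using t_cross_link_link[OF t0] by (simp add: Q01_def)
  have Q010: "Q010 \<subseteq> ksets (X2 - {g}) (k - 1)" "shifted (X2 - {g}) Q010"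
    unfolding Q010_def using without_ksets[OF Q01(1)] shifted_without[OF Q01(2)] by auto
  have "t_cross (Suc 1) Q010 Q010"
    unfolding Q010_def by (rule t_cross_without[OF fin(2) pow[OF Q01(1)] g Q01(2) t01]) simp_all
  then have t010: "t_cross 2 Q010 Q010" by (simp add: numeral_2_eq_2)
  have "card Q00 * card Q00 \<le> (card X2 choose (k - 3)) * (card X2 choose (k - 3))"
    using shifted_product_bound[OF fin(2) _ _ Q00(2,2) t00, of "k - 3" "k - 3"] Q00(1) assms(5) by simp
  then have b00: "card Q00 \<le> (card X - 2) choose (k - 3)"
    unfolding c2[symmetric] by (simp add: mult_le_cancel2 power2_nat_le_eq_le[unfolded power2_eq_square])
  have c3: "card (X2 - {g}) = card X - 3" using g fin c2 by simp
  have "k - 1 = k - 3 + 2" using assms(5) by simp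
  then have "card Q010 * card Q010 \<le> (card (X2 - {g}) choose (k - 3)) * (card (X2 - {g}) choose (k - 3))"
    using shifted_product_bound[OF _ _ _ Q010(2,2) t010, of "k - 3" "k - 3"] Q010(1) fin by simp
  then have b010: "card Q010 \<le> (card X - 3) choose (k - 3)"
    unfolding c3[symmetric] by (simp add: power2_nat_le_eq_le[unfolded power2_eq_square])
  have fQ: "finite Q" "finite Q0" "finite Q01"
    using ksets_sub_finite assms(1,2) fin Q0(1) Q01(1) by blast+
  \<comment> \<open>A set with \<open>f\<close> and \<open>g\<close> but without \<open>e\<close> is
    shifted from \<open>g\<close> to \<open>e\<close>, which injects this class into the sets
    through \<open>e\<close>.\<close>
  have "card (link Q01 g) \<le> card (link Q e)"
  proof -
    let ?\<phi> = "\<lambda>S. insert f S"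
    have "?\<phi> ` link Q01 g \<subseteq> link Q e"
    proof (intro image_subsetI)
      fix S assume "S \<in> link Q01 g"
      then have S: "g \<notin> S" "f \<notin> S" "e \<notin> S" "insert f (insert g S) \<in> Q"
        using efg by (auto simp: link_mem Q01_def Q0_def without_mem)
      then have "swap e g (insert f (insert g S)) \<in> Q"
        using e(1) efg by (intro shiftedD[OF assms(4)]) simp_all
      moreover have "swap e g (insert f (insert g S)) = insert e (insert f S)"
        using S efg by (auto simp: swap_def)
      ultimately show "insert f S \<in> link Q e" using S efg by (auto simp: link_mem)
    qed
    moreover have "inj_on ?\<phi> (link Q01 g)"
      by (rule inj_onI) (auto simp: link_mem Q01_def insert_ident)
    moreover have "finite (link Q e)" using fQ by (simp add: link_eq)
    ultimately show ?thesis by (metis card_inj_on_le)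
  qed
  moreover have "card Q = card (link Q e) + card Q0" unfolding Q0_def by (rule card_link_without[OF fQ(1)])
  moreover have "card Q0 = card Q01 + card Q00"
    unfolding Q01_def Q00_def by (rule card_link_without[OF fQ(2)])
  moreover have "card Q01 = card (link Q01 g) + card Q010"
    unfolding Q010_def by (rule card_link_without[OF fQ(3)])
  ultimately show ?thesis using b00 b010 by (intro exI[of _ e]) linarith
qed

text \<open>The intermediate stage, with uniformities \<open>k - 1\<close> and \<open>k\<close>.
  Only the degrees of the second family are bounded during shifting; those of the first are
  controlled through \<open>heavy\<close>.\<close>

lemma large_degree_cross:
  assumes "finite Y" "P \<subseteq> ksets Y (k - 1)" "Q \<subseteq> ksets Y k" "cross P Q" "cross Q Q"
    and "3 \<le> k" "2 * k \<le> card Y" and u: "u = (card Y - 2) choose (k - 3)"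
    and large: "8 * u < card P" "18 * u < card Q"
  shows "\<exists>w. 8 * u < card (link Q w)"
proof (rule ccontr)
  assume no: "\<not> ?thesis"
  define I where "I A B \<longleftrightarrow> A \<subseteq> ksets Y (k - 1) \<and> B \<subseteq> ksets Y k \<and> cross A B \<and> cross B B \<and>
    card A = card P \<and> card B = card Q" for A B
  \<comment> \<open>Exchange rate \<open>t = 3\<close>. Such a vertex lies in more than
    \<open>17 * u\<close> sets of \<open>B\<close>, which exceeds even the doubled bound
    \<open>16 * u\<close>.\<close>
  have heavy: "card (without B a) < u" if "I A B" "3 * u < card (link A a)" for A B a
  proof -
    have AB: "A \<subseteq> ksets Y (k - 1)" "B \<subseteq> ksets Y k" "cross A B" using that by (auto simp: I_def)
    have "link A a \<noteq> {}" using that by auto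
    then have aY: "a \<in> Y" using degree_outside[OF ksets_Pow[OF AB(1)], of a] by auto
    then have Y': "card (Y - {a}) = card Y - 1" using assms(1) by simp
    have "card (without B a) < (card (Y - {a}) - 3) choose (k - 3)"
    proof (rule cross_star_bound[OF _ link_ksets[OF AB(1)] without_ksets[OF AB(2)]
            cross_link_without[OF AB(3)]])
      show "k - 1 - 1 + k \<le> card (Y - {a})" using assms(6,7) Y' by linarith
      show "(card (Y - {a}) - 1) choose (k - 1 - 1 - 1) \<le> u"
        unfolding u Y' by (simp add: numeral_2_eq_2 numeral_3_eq_3)
    qed (use assms that Y' in auto)
    also have "\<dots> \<le> u" unfolding u by (rule binomial_right_mono) (simp add: Y')
    finally show ?thesis .
  qed
  define J where "J A B \<longleftrightarrow> I A B \<and> (\<forall>w. card (link B w) \<le> 8 * u)" for A B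
  have sub: "A \<subseteq> Pow Y \<and> B \<subseteq> Pow Y" if "J A B" for A B
    using that ksets_Pow unfolding J_def I_def by blast
  have "J P Q" using no assms by (auto simp: J_def I_def not_less)
  have step: "J (shift i j A) (shift i j B)" if "J A B" "i \<in> Y" "i < j" for A B i j
  proof -
    define A' B' where "A' = shift i j A" and "B' = shift i j B"
    have fin: "finite B"
      using that assms(1) ksets_sub_finite unfolding J_def I_def by blast
    have I: "I A' B'"
      using that assms(1) by (simp add: A'_def B'_def J_def I_def card_shift shift_cross shift_ksets)
    then have AB': "A' \<subseteq> ksets Y (k - 1)" "B' \<subseteq> ksets Y k" "cross A' B'" "card A' = card P" "card B' = card Q"
      by (auto simp: I_def)
    have fin': "finite A'" "finite B'" using AB' ksets_sub_finite assms(1) by blast+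
    have small: "card (link B w) \<le> 8 * u" for w using that by (auto simp: J_def)
    have up: "card (link B' i) \<le> 16 * u"
      using shift_degree_up[OF fin, of i j] small[of i] small[of j] unfolding B'_def by linarith
    have other: "card (link B' w) \<le> 8 * u" if "w \<noteq> i" for w
    proof (cases "w = j")
      case True
      then show ?thesis using small[of j] shift_degree_down[OF fin, of i j] \<open>i < j\<close> unfolding B'_def by simp
    next
      case False then show ?thesis using small[of w] shift_degree_other that by (simp add: B'_def)
    qed
    have splitB: "card Q = card (link B' w) + card (without B' w)" for w
      using card_link_without[OF fin'(2)] AB' by simp
    have "card (link B' i) \<le> 8 * u"
    proof (rule ccontr)
      assume block: "\<not> ?thesis"
      have Y': "card (Y - {i}) = card Y - 1" using assms(1) that by simp
      \<comment> \<open>Were \<open>i\<close> heavy in \<open>A'\<close>, its degree in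
        \<open>B'\<close> would exceed the cap \<open>16 * u\<close>. So at least
        \<open>5 * u\<close> sets of \<open>A'\<close> avoid \<open>i\<close>, and together with the
        link of \<open>B'\<close> at \<open>i\<close> they form an equal pair for
        \<open>cross_center\<close>.\<close>
      have light: "card (link A' i) \<le> 3 * u"
        using heavy[OF I, of i] up splitB[of i] large by linarith
      have "card (without A' i) + 3 * u \<ge> card P"
        using card_link_without[OF fin'(1), of i] AB' light by linarith
      then have "5 * u \<le> card (without A' i)" using large by linarith
      moreover have "without A' i \<subseteq> ksets (Y - {i}) (k - 1)" "link B' i \<subseteq> ksets (Y - {i}) (k - 1)"
        using without_ksets[OF AB'(1)] link_ksets[OF AB'(2)] by auto
      moreover have "cross (without A' i) (link B' i)" by (rule cross_without_link[OF AB'(3)])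
      moreover have "u = (card (Y - {i}) - 1) choose (k - 1 - 2)" using u Y' by (simp add: numeral_2_eq_2 numeral_3_eq_3)
      moreover have "2 \<le> k - 1" "2 * (k - 1) \<le> card (Y - {i})" "5 * u \<le> card (link B' i)" "finite (Y - {i})"
        using assms(1,6,7) block Y' by simp_all
      ultimately obtain z where z: "z \<in> Y - {i}" "card (without (without A' i) z) < u"
        using cross_center by metis
      have "card (without A' i) = card (link (without A' i) z) + card (without (without A' i) z)"
        by (rule card_link_without) (use fin' in \<open>simp add: without_def\<close>)
      \<comment> \<open>The centre \<open>z\<close> is heavy in \<open>A'\<close>, hence nearly full
        in \<open>B'\<close>. But \<open>z\<close> differs from \<open>i\<close>, and only
        \<open>i\<close> could have gained degree in this shift.\<close>
      then have "3 * u < card (link A' z)"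
        using link_without_degree[OF fin'(1), of i z] z(2) \<open>5 * u \<le> card (without A' i)\<close> by linarith
      then have "card (without B' z) < u" by (rule heavy[OF I])
      then show False using other[of z] z(1) splitB[of z] large by simp
    qed
    then show ?thesis using other I unfolding J_def A'_def[symmetric] B'_def[symmetric] by metis
  qed
  obtain A B where J: "J A B" and sh: "shifted Y B"
    using shifted_exists[of Y J P Q] assms(1) \<open>J P Q\<close> sub step by meson
  then obtain e where "card B \<le> 2 * card (link B e) + ((card Y - 2) choose (k - 3)) + ((card Y - 3) choose (k - 3))"
    using shifted_intersecting_degree[of Y B k] assms unfolding J_def I_def by force
  moreover have "(card Y - 3) choose (k - 3) \<le> u" unfolding u by (rule binomial_right_mono) simp
  moreover have "card (link B e) \<le> 8 * u" "card B = card Q" using J by (auto simp: J_def I_def)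
  ultimately show False using large u by linarith
qed

lemma choose_Suc_le_double:
  assumes "2 * r \<le> Suc m" shows "Suc m choose r \<le> 2 * (m choose r)"
proof -
  have "(Suc m - r) * (Suc m choose r) = Suc m * (m choose r)"
    using binomial_absorb_comp[of "Suc m" r] by simp
  also have "\<dots> \<le> (2 * (Suc m - r)) * (m choose r)" using assms by (intro mult_le_mono1) linarith
  finally have "(Suc m - r) * (Suc m choose r) \<le> (Suc m - r) * (2 * (m choose r))" by (simp only: ac_simps)
  moreover have "0 < Suc m - r" using assms by linarith
  ultimately show ?thesis using mult_le_cancel1 by blast
qed

text \<open>If the degree of \<open>i\<close> first exceeds \<open>8 * u\<close> in some shift, it
  is still at most \<open>16 * u\<close>, so more than \<open>18 * u\<close> sets avoid
  \<open>i\<close>. \<open>large_degree_cross\<close>, applied to the link of \<open>i\<close> and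
  these sets, produces a second vertex above \<open>8 * u\<close>, although only \<open>i\<close>
  could have gained.\<close>

lemma large_degree:
  assumes "finite X" "G \<subseteq> ksets X k" "cross G G" "3 \<le> k" "2 * k + 1 \<le> card X"
    and u: "u = (card X - 3) choose (k - 3)" and large: "34 * u < card G"
  shows "\<exists>w. 8 * u < card (link G w)"
proof (rule ccontr)
  assume no: "\<not> ?thesis"
  define J where "J A B \<longleftrightarrow> A = B \<and> A \<subseteq> ksets X k \<and> cross A A \<and> card A = card G \<and>
    (\<forall>w. card (link A w) \<le> 8 * u)" for A B
  have sub: "A \<subseteq> Pow X \<and> B \<subseteq> Pow X" if "J A B" for A B
    using that ksets_Pow unfolding J_def by blast
  have "J G G" using no assms by (auto simp: J_def not_less)
  have step: "J (shift i j A) (shift i j B)" if "J A B" "i \<in> X" "i < j" for A B i j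
  proof -
    define A' where "A' = shift i j A"
    have A: "B = A" "A \<subseteq> ksets X k" "cross A A" "card A = card G" "\<And>w. card (link A w) \<le> 8 * u"
      using that by (auto simp: J_def)
    have A': "A' \<subseteq> ksets X k" "cross A' A'" "card A' = card G"
      unfolding A'_def using A that assms(1) by (simp_all add: card_shift shift_cross shift_ksets)
    have fin: "finite A" "finite A'" using A A' ksets_sub_finite assms(1) by blast+
    have up: "card (link A' i) \<le> 16 * u"
      using shift_degree_up[OF fin(1), of i j] A(5)[of i] A(5)[of j] unfolding A'_def by linarith
    have other: "card (link A' w) \<le> 8 * u" if "w \<noteq> i" for w
    proof (cases "w = j")
      case True
      then show ?thesis using A(5)[of j] shift_degree_down[OF fin(1), of i j] \<open>i < j\<close> unfolding A'_def by simp
    next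
      case False then show ?thesis using A(5)[of w] shift_degree_other that by (simp add: A'_def)
    qed
    have "card (link A' i) \<le> 8 * u"
    proof (rule ccontr)
      assume block: "\<not> ?thesis"
      have Y: "card (X - {i}) = card X - 1" using assms(1) that by simp
      have "\<exists>w. 8 * u < card (link (without A' i) w)"
      proof (rule large_degree_cross[OF _ link_ksets[OF A'(1)] without_ksets[OF A'(1)]
            cross_link_without[OF A'(2)] cross_without_without[OF A'(2)]])
        show "u = (card (X - {i}) - 2) choose (k - 3)" using Y u by (simp add: numeral_3_eq_3 numeral_2_eq_2)
        show "18 * u < card (without A' i)"
          using card_link_without[OF fin(2), of i] up large A'(3) by linarith
      qed (use assms block Y in auto)
      then obtain w where w: "8 * u < card (link (without A' i) w)" by blast
      then have "w \<noteq> i" by (metis card.empty link_without_same not_less_zero)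
      then show False using other[of w] link_without_degree[OF fin(2), of i w] w by linarith
    qed
    then show ?thesis using other A' unfolding A(1) J_def A'_def[symmetric] by metis
  qed
  obtain A B where J: "J A B" and sh: "shifted X A"
    using shifted_exists[of X J G G] assms(1) \<open>J G G\<close> sub step by meson
  then obtain e where "card A \<le> 2 * card (link A e) + ((card X - 2) choose (k - 3)) + ((card X - 3) choose (k - 3))"
    using shifted_intersecting_degree[of X A k] assms unfolding J_def by force
  moreover have "(card X - 2) choose (k - 3) \<le> 2 * u"
  proof -
    have "card X - 2 = Suc (card X - 3)" using assms by linarith
    then show ?thesis unfolding u using choose_Suc_le_double[of "k - 3" "card X - 3"] assms by simp
  qed
  moreover have "card (link A e) \<le> 8 * u" "card A = card G" using J by (auto simp: J_def)
  ultimately show False using large u by linarith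
qed

section \<open>The triangle\<close>

text \<open>Fixing the pattern \<open>T\<close> on \<open>J\<close> and deleting \<open>J\<close>
  yields a uniform family on \<open>X - J\<close>; disjoint patterns yield cross-intersecting
  families there, to which the bounds above apply. \<open>num\<close> is its size, used for linear
  arithmetic over patterns.\<close>

definition trace :: "nat set set \<Rightarrow> nat set \<Rightarrow> nat set \<Rightarrow> nat set set" where
  "trace F J T = (\<lambda>S. S - J) ` {S \<in> F. S \<inter> J = T}"

definition num :: "nat set set \<Rightarrow> nat set \<Rightarrow> nat set \<Rightarrow> nat" where
  "num F J T = card {S \<in> F. S \<inter> J = T}"

definition two_of_three :: "nat set \<Rightarrow> nat \<Rightarrow> nat set \<Rightarrow> nat set set" where
  "two_of_three X k J = {S \<in> ksets X k. card (S \<inter> J) = 2}"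

lemma inj_on_trace: "inj_on (\<lambda>S. S - J) {S \<in> F. S \<inter> J = T}"
proof (rule inj_onI)
  fix S S' assume "S \<in> {S \<in> F. S \<inter> J = T}" "S' \<in> {S \<in> F. S \<inter> J = T}" "S - J = S' - J"
  then have "S \<inter> J = S' \<inter> J" "S - J = S' - J" by auto
  then show "S = S'" by (metis Int_Diff_Un)
qed

lemma card_trace: "card (trace F J T) = num F J T"
  unfolding trace_def num_def by (rule card_image[OF inj_on_trace])

lemma card_without_trace:
  assumes "z \<notin> J" "z \<notin> T"
  shows "card (without (trace F J T) z) = num F (insert z J) T"
proof -
  have "without (trace F J T) z = (\<lambda>S. S - J) ` {S \<in> F. S \<inter> insert z J = T}"
    using assms by (auto simp: without_def trace_def)
  moreover have "inj_on (\<lambda>S. S - J) {S \<in> F. S \<inter> insert z J = T}"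
    by (rule inj_on_subset[OF inj_on_trace[of J F T]]) (use assms in auto)
  ultimately show ?thesis unfolding num_def by (simp add: card_image)
qed

lemma trace_ksets:
  assumes "finite X" "F \<subseteq> ksets X k" shows "trace F J T \<subseteq> ksets (X - J) (k - card T)"
proof
  fix U assume "U \<in> trace F J T"
  then obtain S where S: "S \<in> F" "S \<inter> J = T" "U = S - J" by (auto simp: trace_def)
  then have "S \<subseteq> X" "card S = k" using assms(2) by (auto simp: ksets_def)
  moreover have "finite S" using \<open>S \<subseteq> X\<close> assms(1) by (rule finite_subset)
  ultimately show "U \<in> ksets (X - J) (k - card T)"
    using S by (auto simp: ksets_def card_Diff_subset_Int)
qed

lemma trace_cross: "cross F G \<Longrightarrow> T \<inter> T' = {} \<Longrightarrow> cross (trace F J T) (trace G J T')"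
  unfolding cross_def trace_def by blast

lemma num_split:
  assumes "finite F" "z \<notin> J" "z \<notin> T"
  shows "num F J T = num F (insert z J) T + num F (insert z J) (insert z T)"
proof -
  have "{S \<in> F. S \<inter> J = T} = {S \<in> F. S \<inter> insert z J = T} \<union> {S \<in> F. S \<inter> insert z J = insert z T}"
    using assms by auto
  moreover have "{S \<in> F. S \<inter> insert z J = T} \<inter> {S \<in> F. S \<inter> insert z J = insert z T} = {}"
    using assms by blast
  ultimately show ?thesis using assms(1) by (simp add: num_def card_Un_disjoint)
qed

lemma num_degree: "num F {x} {x} = card (link F x)" "num F {x} {} = card (without F x)"
  unfolding num_def card_link without_def by (rule arg_cong[where f = card], auto)+

lemma degree_triple:
  assumes "finite F" "x \<noteq> y" "x \<noteq> z" "y \<noteq> z"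
  shows "card (link F x) =
      num F {x, y, z} {x} + num F {x, y, z} {x, y} + num F {x, y, z} {x, z} + num F {x, y, z} {x, y, z}"
    and "card (without F x) =
      num F {x, y, z} {} + num F {x, y, z} {y} + num F {x, y, z} {z} + num F {x, y, z} {y, z}"
  using assms num_split[OF assms(1), of y "{x}" "{x}"] num_split[OF assms(1), of z "{x, y}" "{x}"]
    num_split[OF assms(1), of z "{x, y}" "{x, y}"] num_split[OF assms(1), of y "{x}" "{}"]
    num_split[OF assms(1), of z "{x, y}" "{}"] num_split[OF assms(1), of z "{x, y}" "{y}"]
  by (simp_all add: num_degree insert_commute)

lemma num_star_bound:
  assumes "finite X" "F \<subseteq> ksets X k" "cross F F" "J \<subseteq> X" "card J = 3" "T \<inter> T' = {}" "card T = 2"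
    and "3 \<le> k" "2 * k + 3 \<le> card X" "t \<le> k - card T'"
    and u: "u = (card X - 4) choose (k - 3)" and "t * u < num F J T"
  shows "num F J T' < (card X - 3 - t) choose (k - card T' - t)"
proof -
  have X: "card (X - J) = card X - 3" using assms(1,4,5) by (metis card_Diff_subset finite_subset)
  have "card (trace F J T') < (card (X - J) - t) choose (k - card T' - t)"
  proof (rule cross_star_bound[OF _ trace_ksets[OF assms(1,2)] trace_ksets[OF assms(1,2)]
        trace_cross[OF assms(3,6)]])
    show "(card (X - J) - 1) choose (k - card T - 1) \<le> u" using X u assms(7) by (simp add: numeral_eq_Suc)
  qed (use assms X in \<open>auto simp: card_trace\<close>)
  then show ?thesis by (simp add: X card_trace)
qed

text \<open>The vertex \<open>x\<close> has maximum degree, and \<open>y\<close> has large degree among the sets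
  avoiding \<open>x\<close>; then the two large cross-intersecting families \<open>\<F>(x) \<setminus> y\<close> and
  \<open>\<F>(y) \<setminus> x\<close> share a centre \<open>z\<close>.\<close>

lemma triple_exists:
  assumes "finite X" "F \<subseteq> ksets X k" "cross F F" "3 \<le> k" "42 * k \<le> card X"
    and u: "u = (card X - 4) choose (k - 3)" and large: "\<And>x. x \<in> X \<Longrightarrow> 42 * u \<le> card (without F x)"
  obtains x y z where "x \<noteq> y" "x \<noteq> z" "y \<noteq> z" "{x, y, z} \<subseteq> X"
    "\<And>v. v \<in> {x, y, z} \<Longrightarrow> num F {x, y, z} {v} < (card X - 5) choose (k - 3)"
    "num F {x, y, z} {} < (card X - 6) choose (k - 3)"
proof -
  have finF: "finite F" using ksets_sub_finite assms(1,2) by blast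
  have upos: "0 < u" unfolding u using assms(4,5) by (simp add: zero_less_binomial)
  have "X \<noteq> {}" using assms(4,5) by auto
  define d where "d = Max ((\<lambda>x. card (link F x)) ` X)"
  have "d \<in> (\<lambda>x. card (link F x)) ` X"
    unfolding d_def using \<open>X \<noteq> {}\<close> assms(1) by (intro Max_in) auto
  then obtain x where x: "x \<in> X" "card (link F x) = d" by auto
  then have xmax: "card (link F w) \<le> card (link F x)" if "w \<in> X" for w
    using that assms(1) by (simp add: d_def)
  let ?G = "without F x"
  have X1: "card (X - {x}) = card X - 1" using x assms(1) by simp
  have "2 * k + 1 \<le> card (X - {x})" using X1 assms(4,5) by linarith
  then obtain y where y: "8 * u < card (link ?G y)"
    using large_degree[OF _ without_ksets[OF assms(2)] cross_without_without[OF assms(3)], of x u]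
      assms large[OF x(1)] upos X1 by auto
  then have "link ?G y \<noteq> {}" by auto
  then have yX: "y \<in> X - {x}" using degree_outside[OF ksets_Pow[OF without_ksets[OF assms(2)]], of y x] by auto
  then have xy: "x \<noteq> y" "y \<in> X" by auto
  have cy: "card (link ?G y) = num F {x, y} {y}"
    unfolding card_link num_def by (rule arg_cong[where f = card]) (use xy in \<open>auto simp: without_def\<close>)
  have degx: "card (link F x) = num F {x, y} {x} + num F {x, y} {x, y}"
    using num_split[OF finF, of y "{x}" "{x}"] xy by (simp add: num_degree insert_commute)
  have degy: "card (link F y) = num F {x, y} {y} + num F {x, y} {x, y}"
    using num_split[OF finF, of x "{y}" "{y}"] xy by (simp add: num_degree insert_commute)
  \<comment> \<open>Since \<open>x\<close> has maximum degree and the sets containing both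
    \<open>x\<close> and \<open>y\<close> count for both degrees, the sets with \<open>x\<close> but
    not \<open>y\<close> are at least as many as those with \<open>y\<close> but not
    \<open>x\<close>.\<close>
  have big: "8 * u < num F {x, y} {y}" "8 * u < num F {x, y} {x}"
    using y cy degx degy xmax[OF xy(2)] by linarith+
  define u' where "u' = (card X - 3) choose (k - 3)"
  \<comment> \<open>\<open>cross_center\<close> on \<open>X - {x, y}\<close> measures in
    \<open>(n - 3) choose (k - 3)\<close> where \<open>n = card X\<close>, slightly more than
    \<open>u\<close>; the surplus of \<open>8 * u\<close> over \<open>5 * u\<close> absorbs the
    difference.\<close>
  have u': "5 * u' \<le> 8 * u"
  proof -
    have "card X - 3 - (k - 3) = card X - k" using assms(4,5) by simp
    then have eq: "(card X - k) * u' = (card X - 3) * u"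
      using binomial_absorb_comp[of "card X - 3" "k - 3"] by (simp add: u u'_def)
    have "(card X - k) * (5 * u') = 5 * ((card X - k) * u')" by simp
    also have "\<dots> = 5 * (card X - 3) * u" by (simp only: eq mult.assoc)
    also have "\<dots> \<le> 8 * (card X - k) * u"
      by (rule mult_le_mono1) (use assms(4,5) in linarith)
    also have "\<dots> = (card X - k) * (8 * u)" by simp
    finally have "(card X - k) * (5 * u') \<le> (card X - k) * (8 * u)" .
    moreover have "0 < card X - k" using assms(4,5) by linarith
    ultimately show ?thesis using mult_le_cancel1 by blast
  qed
  define Y where "Y = X - {x, y}"
  have Y: "finite Y" "card Y = card X - 2" unfolding Y_def using assms(1) x xy
    by (simp_all add: card_Diff_subset)
  have "trace F {x, y} {x} \<subseteq> ksets Y (k - 1)" "trace F {x, y} {y} \<subseteq> ksets Y (k - 1)"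
    unfolding Y_def using trace_ksets[OF assms(1,2), of "{x, y}" "{x}"]
      trace_ksets[OF assms(1,2), of "{x, y}" "{y}"] by simp_all
  moreover have "cross (trace F {x, y} {x}) (trace F {x, y} {y})"
    by (rule trace_cross[OF assms(3)]) (use xy in auto)
  moreover have "2 \<le> k - 1" "2 * (k - 1) \<le> card Y" using assms(4,5) Y by linarith+
  moreover have "u' = (card Y - 1) choose (k - 1 - 2)" unfolding u'_def Y by (simp add: numeral_eq_Suc)
  moreover have "5 * u' \<le> card (trace F {x, y} {x})" "5 * u' \<le> card (trace F {x, y} {y})"
    using big u' by (simp_all add: card_trace)
  ultimately obtain z where z: "z \<in> Y" "card (without (trace F {x, y} {x}) z) < u'"
      "card (without (trace F {x, y} {y}) z) < u'"
    using cross_center Y(1) by metis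
  then have zX: "z \<in> X" "z \<noteq> x" "z \<noteq> y" by (auto simp: Y_def)
  define J where "J = {x, y, z}"
  have J: "J \<subseteq> X" "card J = 3" "insert z {x, y} = J" using xy zX x by (auto simp: J_def)
  have s: "num F J {x} < u'" "num F J {y} < u'"
    using z card_without_trace[of z "{x, y}" "{x}" F] card_without_trace[of z "{x, y}" "{y}" F] zX J by simp_all
  have "num F {x, y} {x} = num F J {x} + num F J {x, z}" "num F {x, y} {y} = num F J {y} + num F J {y, z}"
    using num_split[OF finF, of z "{x, y}" "{x}"] num_split[OF finF, of z "{x, y}" "{y}"] zX J
    by (simp_all add: insert_commute)
  then have xz: "3 * u < num F J {x, z}" and yz: "3 * u < num F J {y, z}" using big s u' upos by linarith+
  have X6: "2 * k + 3 \<le> card X" using assms(4,5) by linarith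
  note star = num_star_bound[OF assms(1-3) J(1,2) _ _ assms(4) X6 _ u]
  have k3: "k - 1 - 2 = k - 3" by simp
  have n0: "num F J {} < (card X - 6) choose (k - 3)"
    using star[of "{y, z}" "{}" 3] yz zX assms(4) by simp
  have nx: "num F J {x} < (card X - 5) choose (k - 3)"
    using star[of "{y, z}" "{x}" 2] yz zX xy assms(4) k3 by simp
  have ny: "num F J {y} < (card X - 5) choose (k - 3)"
    using star[of "{x, z}" "{y}" 2] xz zX xy assms(4) k3 by simp
  have le: "(card X - 5) choose (k - 3) \<le> u" "(card X - 6) choose (k - 3) \<le> u"
    unfolding u by (rule binomial_right_mono; simp)+
  \<comment> \<open>So far nothing is known about the pattern \<open>{x, y}\<close>. Of the at least
    \<open>42 * u\<close> sets avoiding \<open>z\<close>, the other three patterns take fewer than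
    \<open>3 * u\<close>, and this makes the roles of \<open>x\<close>, \<open>y\<close>,
    \<open>z\<close> symmetric.\<close>
  have "card (without F z) = num F J {} + num F J {x} + num F J {y} + num F J {x, y}"
    using degree_triple(2)[OF finF, of z x y] xy zX by (simp add: J_def insert_commute)
  then have "2 * u < num F J {x, y}" using large[OF zX(1)] n0 nx ny le upos by linarith
  then have nz: "num F J {z} < (card X - 5) choose (k - 3)"
    using star[of "{x, y}" "{z}" 2] zX xy assms(4) k3 by simp
  show ?thesis
    by (rule that[of x y z]) (use xy zX x nx ny nz n0 in \<open>auto simp: J_def\<close>)
qed

section \<open>Exceptional sets against missing sets\<close>

text \<open>Locate \<open>card B\<close> between consecutive star sizes
  \<open>(m - s) choose (b - s)\<close>. Kruskal--Katona at \<open>Suc s\<close> bounds what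
  \<open>A\<close> misses from below by \<open>(m - s - 1) choose a\<close>, and
  \<open>ratio\<close> compares this with the star size at \<open>s\<close>.\<close>

lemma cross_deficit:
  assumes "finite X" "A \<subseteq> ksets X a" "B \<subseteq> ksets X b" "cross A B" "a + b < card X" "t \<le> b"
    and small: "card B < (card X - t) choose (b - t)"
    and ratio: "c * ((card X - t) choose (b - t)) \<le> d * ((card X - t - 1) choose a)"
  shows "c * card B \<le> d * ((card X choose a) - card A)"
proof -
  define m where "m = card X"
  \<comment> \<open>Passing from \<open>s\<close> to \<open>Suc s\<close> multiplies the left
    binomial by \<open>q / p\<close> and the right one by \<open>(p - 1 - a) / (p - 1)\<close>; the
    latter factor is not smaller because \<open>a + b < m\<close>.\<close>
  have ratio': "c * ((m - s) choose (b - s)) \<le> d * ((m - s - 1) choose a)" if "t \<le> s" "s \<le> b" for s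
    using that
  proof (induction s rule: dec_induct)
    case base then show ?case using ratio by (simp add: m_def)
  next
    case (step s)
    define p q where "p = m - s" and "q = b - s"
    have pq: "0 < p" "0 < q" "q \<le> p - 1 - a" "m - Suc s = p - 1" "b - Suc s = q - 1"
      using step assms(5) by (simp_all add: p_def q_def m_def)
    have IH: "c * (p choose q) \<le> d * ((p - 1) choose a)" using step by (simp add: p_def q_def)
    have "p * (c * ((p - 1) choose (q - 1))) = q * (c * (p choose q))"
      using times_binomial_minus1_eq[OF pq(2), of p] by simp
    also have "\<dots> \<le> (p - 1 - a) * (d * ((p - 1) choose a))"
      by (rule mult_le_mono[OF pq(3) IH])
    also have "\<dots> = d * ((p - 1) * ((p - 1 - 1) choose a))"
      using binomial_absorb_comp[of "p - 1" a] by simp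
    also have "\<dots> \<le> p * (d * ((p - 1 - 1) choose a))"
      by (simp add: ac_simps mult_le_mono)
    finally have "p * (c * ((p - 1) choose (q - 1))) \<le> p * (d * ((p - 1 - 1) choose a))" .
    then show ?case using pq(1,4,5) by simp
  qed
  show ?thesis
  proof (cases "card B = 0")
    case True then show ?thesis by simp
  next
    case False
    let ?P = "\<lambda>s. s \<le> b \<and> card B < (m - s) choose (b - s)"
    define s where "s = (GREATEST s. ?P s)"
    have P: "?P t" using assms(6) small by (simp add: m_def)
    have s: "?P s" unfolding s_def by (rule GreatestI_nat[of ?P t b, OF P]) simp
    have mx: "s' \<le> s" if "?P s'" for s'
      unfolding s_def by (rule Greatest_le_nat[of ?P s' b, OF that]) simp
    have ts: "t \<le> s" by (rule mx[OF P])
    \<comment> \<open>At \<open>s = b\<close> the star size is 1, which would make \<open>B\<close>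
      empty.\<close>
    have "s \<noteq> b" using s False by auto
    then have sb: "Suc s \<le> b" using s by simp
    have "\<not> ?P (Suc s)" using mx[of "Suc s"] by auto
    then have "(card X - Suc s) choose (b - Suc s) \<le> card B" using sb by (simp add: m_def)
    then have "card A + ((card X - Suc s) choose a) \<le> card X choose a"
      using cross_bound[OF assms(1-4) _ sb] assms(5) by simp
    then have "(m - s - 1) choose a \<le> (card X choose a) - card A" by (simp add: m_def)
    moreover have "c * card B \<le> c * ((m - s) choose (b - s))" using s by simp
    ultimately show ?thesis using ratio'[OF ts] s by (meson le_trans mult_le_mono2)
  qed
qed

text \<open>With \<open>r = k - 3\<close> the quotient of the two binomials is
  \<open>(N + 1) * (r + 1) / ((N + 1 - r) * (N - r))\<close>, roughly \<open>k / n\<close>; the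
  factor 2 pays for the lower-order terms.\<close>

lemma choose_ratio:
  assumes "3 \<le> k" "k - 2 \<le> N" "n * Suc N \<le> 2 * (Suc N - (k - 3)) * (N - (k - 3))"
  shows "n * (Suc N choose (k - 3)) \<le> 2 * k * (N choose (k - 2))"
proof -
  define r where "r = k - 3"
  have r: "k - 2 = Suc r" "k - 3 = r" using assms(1) by (auto simp: r_def)
  have rN: "Suc r \<le> N" using assms(2) r by simp
  have 1: "(Suc N - r) * (Suc N choose r) = Suc N * (N choose r)"
    using binomial_absorb_comp[of "Suc N" r] by simp
  have 2: "Suc r * (N choose Suc r) = (N - r) * (N choose r)"
    using binomial_absorb_comp[of N r] binomial_absorption[of r N] by simp
  have "(Suc N - r) * (n * (Suc N choose r)) = n * Suc N * (N choose r)" using 1 by (metis mult.assoc mult.left_commute)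
  also have "\<dots> \<le> 2 * (Suc N - r) * (N - r) * (N choose r)"
    using assms(3) r by (intro mult_le_mono1) simp
  also have "\<dots> = (Suc N - r) * (2 * (Suc r * (N choose Suc r)))" using 2 by (simp only: ac_simps)
  also have "\<dots> \<le> (Suc N - r) * (2 * (k * (N choose Suc r)))"
    using r assms(1) by (intro mult_le_mono mult_le_mono1) simp_all
  finally have "(Suc N - r) * (n * (Suc N choose r)) \<le> (Suc N - r) * (2 * k * (N choose Suc r))"
    by (simp only: ac_simps)
  moreover have "0 < Suc N - r" using rN by simp
  ultimately show ?thesis unfolding r using mult_le_cancel1 by blast
qed

section \<open>Size and degrees of the triangle family\<close>

lemma card_with_trace:
  assumes "finite X" "J \<subseteq> X" "T \<subseteq> J" "card T \<le> k"
  shows "card {S \<in> ksets X k. S \<inter> J = T} = (card X - card J) choose (k - card T)"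
proof -
  have fJ: "finite J" "finite T" using assms finite_subset by metis+
  have "{S \<in> ksets X k. S \<inter> J = T} = (\<lambda>U. U \<union> T) ` ksets (X - J) (k - card T)"
  proof (intro equalityI subsetI)
    fix S assume S: "S \<in> {S \<in> ksets X k. S \<inter> J = T}"
    then have "S - J \<in> trace (ksets X k) J T" by (auto simp: trace_def)
    then have "S - J \<in> ksets (X - J) (k - card T)" using trace_ksets[OF assms(1) subset_refl] by blast
    moreover have "S = (S - J) \<union> T" using S by auto
    ultimately show "S \<in> (\<lambda>U. U \<union> T) ` ksets (X - J) (k - card T)" by blast
  next
    fix S assume "S \<in> (\<lambda>U. U \<union> T) ` ksets (X - J) (k - card T)"
    then obtain U where U: "U \<subseteq> X - J" "card U = k - card T" "S = U \<union> T" by (auto simp: ksets_def)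
    moreover have "finite U" using U(1) assms(1) by (meson finite_Diff finite_subset)
    moreover have "U \<inter> T = {}" using U(1) assms(3) by blast
    ultimately have "card S = k" using assms(4) fJ by (simp add: card_Un_disjoint)
    then show "S \<in> {S \<in> ksets X k. S \<inter> J = T}" using U assms by (auto simp: ksets_def)
  qed
  moreover have "inj_on (\<lambda>U. U \<union> T) (ksets (X - J) (k - card T))"
    by (rule inj_onI) (use assms(3) in \<open>unfold ksets_def, blast\<close>)
  ultimately show ?thesis
    using assms(1,2) fJ by (simp add: card_image card_ksets card_Diff_subset)
qed

lemma card_triple:
  assumes "F \<subseteq> ksets X k" "finite X" "J = {x, y, z}" "x \<noteq> y" "x \<noteq> z" "y \<noteq> z"
  shows "card F = num F J {} + (num F J {x} + num F J {y} + num F J {z})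
    + (num F J {x, y} + num F J {x, z} + num F J {y, z}) + num F J {x, y, z}"
proof -
  have fin: "finite F" using ksets_sub_finite assms(1,2) by blast
  show ?thesis
    using card_link_without[OF fin, of x] degree_triple[OF fin assms(4-6)] assms(3) by simp
qed

lemma subset_triple:
  assumes "U \<subseteq> {x, y, z}"
  shows "U \<in> {{}, {x}, {y}, {z}, {x, y}, {x, z}, {y, z}, {x, y, z}}"
proof -
  have "U \<in> Pow {x, y, z}" using assms by blast
  then show ?thesis by (auto simp: Pow_insert)
qed

lemma card_eq_2_subsets:
  assumes "x \<noteq> y" "x \<noteq> z" "y \<noteq> z" "U \<subseteq> {x, y, z}"
  shows "card U = 2 \<longleftrightarrow> U = {x, y} \<or> U = {x, z} \<or> U = {y, z}"
  using subset_triple[OF assms(4)] assms(1-3) by (elim insertE) (auto simp: doubleton_eq_iff)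

lemma num_two_of_three:
  assumes "finite X" "card J = 3" "J \<subseteq> X" "T \<subseteq> J" "2 \<le> k"
  shows "num (two_of_three X k J) J T = (if card T = 2 then (card X - 3) choose (k - 2) else 0)"
proof (cases "card T = 2")
  case True
  then have "{S \<in> two_of_three X k J. S \<inter> J = T} = {S \<in> ksets X k. S \<inter> J = T}"
    by (auto simp: two_of_three_def)
  then show ?thesis using card_with_trace[OF assms(1,3,4), of k] True assms(2,5) by (simp add: num_def)
next
  case False
  then have "{S \<in> two_of_three X k J. S \<inter> J = T} = {}" by (auto simp: two_of_three_def)
  then have "num (two_of_three X k J) J T = 0" by (metis card.empty num_def)
  then show ?thesis using False by simp
qed

text \<open>A vertex of \<open>J\<close> belongs to two of the three pairs. A vertex outside lies in
  \<open>3 * u\<close> sets, and \<open>(k - 2) * w = (n - 3) * u\<close>, where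
  \<open>n = card X\<close>, makes this at most \<open>2 * w\<close>.\<close>

lemma two_of_three_degree:
  assumes "finite X" "J \<subseteq> X" "card J = 3" "3 \<le> k" "42 * k \<le> card X" "v \<in> X"
  shows "card (link (two_of_three X k J) v) \<le> 2 * ((card X - 3) choose (k - 2))"
proof (cases "v \<in> J")
  case True
  define T where "T = two_of_three X k J"
  have fin: "finite T" by (rule ksets_sub_finite[OF assms(1), of _ k]) (auto simp: T_def two_of_three_def)
  have "card (J - {v}) = 2" using assms(3) True by (simp add: card_Diff_singleton)
  then obtain y z where yz: "J - {v} = {y, z}" "y \<noteq> z" by (auto simp: card_2_iff)
  then have J: "J = {v, y, z}" "v \<noteq> y" "v \<noteq> z" using True by auto
  have n: "num T J U = (if card U = 2 then (card X - 3) choose (k - 2) else 0)" if "U \<subseteq> J" for U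
    unfolding T_def using num_two_of_three[OF assms(1,3,2) that] assms(4) by simp
  from n[of J] have "num T J J = 0" using assms(3) by simp
  moreover from n[of "{v}"] n[of "{v, y}"] n[of "{v, z}"]
  have "num T J {v} = 0" "num T J {v, y} = (card X - 3) choose (k - 2)"
    "num T J {v, z} = (card X - 3) choose (k - 2)"
    using J yz(2) by simp_all
  ultimately show ?thesis
    using degree_triple(1)[OF fin J(2,3) yz(2), folded J(1)] unfolding T_def by linarith
next
  case False
  define w where "w = (card X - 3) choose (k - 2)"
  define u where "u = (card X - 4) choose (k - 3)"
  obtain x y z where J: "J = {x, y, z}" "x \<noteq> y" "x \<noteq> z" "y \<noteq> z"
    using assms(3) by (auto simp: card_3_iff)
  let ?c = "\<lambda>U. {S \<in> ksets X k. S \<inter> insert v J = insert v U}"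
  have cu: "card (?c U) = u" if "U \<subseteq> J" "card U = 2" for U
  proof -
    have "finite J" using assms(1,2) finite_subset by blast
    then have "finite U" "v \<notin> U" using that False finite_subset by blast+
    then have "card (insert v U) = 3" using that by simp
    moreover have "card (insert v J) = 4" using False assms(3) \<open>finite J\<close> by simp
    ultimately show ?thesis
      using card_with_trace[OF assms(1), of "insert v J" "insert v U" k] that assms(2,4,6)
      by (auto simp: u_def)
  qed
  have fin: "finite (?c U)" for U using ksets_finite[OF assms(1)] by simp
  have "{S \<in> two_of_three X k J. v \<in> S} \<subseteq> ?c {x, y} \<union> ?c {x, z} \<union> ?c {y, z}"
  proof
    fix S assume "S \<in> {S \<in> two_of_three X k J. v \<in> S}"
    then have S: "S \<in> ksets X k" "v \<in> S" "card (S \<inter> J) = 2" by (auto simp: two_of_three_def)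
    then have "S \<inter> J = {x, y} \<or> S \<inter> J = {x, z} \<or> S \<inter> J = {y, z}"
      using card_eq_2_subsets[OF J(2-4), of "S \<inter> J"] J(1) by auto
    moreover have "S \<inter> insert v J = insert v (S \<inter> J)" using S by auto
    ultimately show "S \<in> ?c {x, y} \<union> ?c {x, z} \<union> ?c {y, z}" using S by auto
  qed
  then have "card {S \<in> two_of_three X k J. v \<in> S} \<le> card (?c {x, y} \<union> ?c {x, z} \<union> ?c {y, z})"
    using fin by (intro card_mono) auto
  also have "\<dots> \<le> card (?c {x, y}) + card (?c {x, z}) + card (?c {y, z})"
    using card_Un_le[of "?c {x, y} \<union> ?c {x, z}" "?c {y, z}"] card_Un_le[of "?c {x, y}" "?c {x, z}"] by linarith
  also have "\<dots> = 3 * u" using cu[of "{x, y}"] cu[of "{x, z}"] cu[of "{y, z}"] J by simp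
  also have "\<dots> \<le> 2 * w"
  proof -
    have eq: "(k - 2) * w = (card X - 3) * u"
      using times_binomial_minus1_eq[of "k - 2" "card X - 3"] assms(4) by (simp add: w_def u_def)
    have "(k - 2) * (3 * u) = (3 * (k - 2)) * u" by simp
    also have "\<dots> \<le> (2 * (card X - 3)) * u"
      by (rule mult_le_mono1) (use assms(4,5) in linarith)
    also have "\<dots> = 2 * ((k - 2) * w)" by (simp only: eq mult.assoc)
    finally have "(k - 2) * (3 * u) \<le> (k - 2) * (2 * w)" by (simp only: ac_simps)
    moreover have "0 < k - 2" using assms(4) by simp
    ultimately show ?thesis using mult_le_cancel1 by blast
  qed
  finally show ?thesis by (simp add: card_link w_def)
qed

lemma card_two_of_three:
  assumes "finite X" "J \<subseteq> X" "card J = 3" "2 \<le> k"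
  shows "card (two_of_three X k J) = 3 * ((card X - 3) choose (k - 2))"
proof -
  obtain x y z where J: "J = {x, y, z}" "x \<noteq> y" "x \<noteq> z" "y \<noteq> z"
    using assms(3) by (auto simp: card_3_iff)
  have "num (two_of_three X k J) J U = (if card U = 2 then (card X - 3) choose (k - 2) else 0)"
    if "U \<subseteq> J" for U using num_two_of_three[OF assms(1,3,2) that assms(4)] .
  from this[of "{}"] this[of "{x}"] this[of "{y}"] this[of "{z}"] this[of "{x, y}"] this[of "{x, z}"]
    this[of "{y, z}"] this[of "{x, y, z}"]
  have "num (two_of_three X k J) J {} = 0" "num (two_of_three X k J) J {x} = 0"
    "num (two_of_three X k J) J {y} = 0" "num (two_of_three X k J) J {z} = 0"
    "num (two_of_three X k J) J {x, y} = (card X - 3) choose (k - 2)"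
    "num (two_of_three X k J) J {x, z} = (card X - 3) choose (k - 2)"
    "num (two_of_three X k J) J {y, z} = (card X - 3) choose (k - 2)"
    "num (two_of_three X k J) J {x, y, z} = 0"
    using J by simp_all
  moreover have "two_of_three X k J \<subseteq> ksets X k" by (auto simp: two_of_three_def)
  ultimately show ?thesis
    using card_triple[OF _ assms(1) J, of "two_of_three X k J" k] by linarith
qed

section \<open>Translation to the ground set \<open>{1..n}\<close> and isomorphism\<close>

lemma k_subsets_eq: "k_subsets n k = ksets {1..n} k"
  by (simp add: k_subsets_def ksets_def)

lemma triangle_family_eq: "triangle_family n k = two_of_three {1..n} k {1, 2, 3}"
  by (simp add: triangle_family_def two_of_three_def k_subsets_eq)

lemma intersecting_eq: "intersecting F \<longleftrightarrow> cross F F"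
  by (simp add: intersecting_def cross_def)

lemma degree_le_max_degree: "x \<in> {1..n} \<Longrightarrow> card (link F x) \<le> max_degree n F"
  unfolding max_degree_def by (intro Max_ge) auto

text \<open>One inclusion is proved for all permutations; the inverse permutation supplies the
  other.\<close>

lemma permutes_image_two_of_three:
  assumes "\<pi> permutes X"
  shows "(\<lambda>S. \<pi> ` S) ` two_of_three X k J = two_of_three X k (\<pi> ` J)"
proof -
  have sub: "(\<lambda>S. \<sigma> ` S) ` two_of_three X k J \<subseteq> two_of_three X k (\<sigma> ` J)" if "\<sigma> permutes X" for \<sigma> J
  proof (rule image_subsetI)
    fix S assume S: "S \<in> two_of_three X k J"
    have inj: "inj \<sigma>" using that permutes_inj by blast
    have "\<sigma> ` S \<subseteq> X" using S permutes_image[OF that] by (auto simp: two_of_three_def ksets_def)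
    moreover have "card (\<sigma> ` S \<inter> \<sigma> ` J) = card (S \<inter> J)"
      unfolding image_Int[OF inj, symmetric] by (rule card_image) (rule inj_on_subset[OF inj], simp)
    moreover have "card (\<sigma> ` S) = card S" by (rule card_image) (rule inj_on_subset[OF inj], simp)
    ultimately show "\<sigma> ` S \<in> two_of_three X k (\<sigma> ` J)"
      using S by (auto simp: two_of_three_def ksets_def)
  qed
  show ?thesis
  proof (rule equalityI[OF sub[OF assms]], rule subsetI)
    fix S assume S: "S \<in> two_of_three X k (\<pi> ` J)"
    have inv: "inv \<pi> ` \<pi> ` A = A" "\<pi> ` inv \<pi> ` A = A" for A
      using permutes_inverses[OF assms] by (auto simp: image_image)
    have "inv \<pi> ` S \<in> two_of_three X k J"
      using sub[OF permutes_inv[OF assms], of "\<pi> ` J"] S inv(1)[of J] by auto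
    then show "S \<in> (\<lambda>S. \<pi> ` S) ` two_of_three X k J" using inv(2)[of S] by (metis imageI)
  qed
qed

lemma exists_permutes_image:
  assumes "finite X" "A \<subseteq> X" "B \<subseteq> X" "card A = card B"
  obtains \<pi> where "\<pi> permutes X" "\<pi> ` A = B"
proof -
  have fin: "finite A" "finite B" using assms finite_subset by blast+
  obtain f where f: "bij_betw f A B" using finite_same_card_bij[OF fin assms(4)] by blast
  have "card (X - A) = card (X - B)" using assms fin by (simp add: card_Diff_subset)
  then obtain g where g: "bij_betw g (X - A) (X - B)"
    using finite_same_card_bij[of "X - A" "X - B"] assms(1) by auto
  define \<pi> where "\<pi> x = (if x \<in> A then f x else if x \<in> X then g x else x)" for x
  have 1: "bij_betw \<pi> A B" using f by (rule bij_betw_cong[THEN iffD1, rotated]) (simp add: \<pi>_def)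
  have 2: "bij_betw \<pi> (X - A) (X - B)" using g by (rule bij_betw_cong[THEN iffD1, rotated]) (simp add: \<pi>_def)
  have "bij_betw \<pi> (A \<union> (X - A)) (B \<union> (X - B))"
    by (rule bij_betw_combine[OF 1 2]) blast
  moreover have "A \<union> (X - A) = X" "B \<union> (X - B) = X" using assms by auto
  ultimately have "bij_betw \<pi> X X" by simp
  then have "\<pi> permutes X" by (rule bij_imp_permutes) (use assms(2) in \<open>auto simp: \<pi>_def\<close>)
  moreover have "\<pi> ` A = B" using 1 by (simp add: bij_betw_def)
  ultimately show ?thesis by (rule that)
qed

lemma isomorphic_triangle_iff:
  assumes "3 \<le> n"
  shows "isomorphic_families n F (triangle_family n k) \<longleftrightarrow>
    (\<exists>J. J \<subseteq> {1..n} \<and> card J = 3 \<and> F = two_of_three {1..n} k J)"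
proof
  assume "isomorphic_families n F (triangle_family n k)"
  then obtain \<pi> where \<pi>: "\<pi> permutes {1..n}" "F = two_of_three {1..n} k (\<pi> ` {1, 2, 3})"
    unfolding isomorphic_families_def triangle_family_eq by (metis permutes_image_two_of_three)
  have "\<pi> ` {1, 2, 3} \<subseteq> \<pi> ` {1..n}" using assms by (intro image_mono) auto
  then have "\<pi> ` {1, 2, 3} \<subseteq> {1..n}" using permutes_image[OF \<pi>(1)] by simp
  moreover have "card (\<pi> ` {1, 2, 3}) = card {1, 2, 3 :: nat}"
    by (rule card_image) (rule inj_on_subset[OF permutes_inj[OF \<pi>(1)]], simp)
  ultimately show "\<exists>J. J \<subseteq> {1..n} \<and> card J = 3 \<and> F = two_of_three {1..n} k J"
    using \<pi>(2) by (intro exI[of _ "\<pi> ` {1, 2, 3}"]) simp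
next
  assume "\<exists>J. J \<subseteq> {1..n} \<and> card J = 3 \<and> F = two_of_three {1..n} k J"
  then obtain J where J: "J \<subseteq> {1..n}" "card J = 3" "F = two_of_three {1..n} k J" by blast
  obtain \<pi> where \<pi>: "\<pi> permutes {1..n}" "\<pi> ` {1, 2, 3} = J"
    by (rule exists_permutes_image[of "{1..n}" "{1, 2, 3}" J]) (use assms J in auto)
  then show "isomorphic_families n F (triangle_family n k)"
    unfolding isomorphic_families_def triangle_family_eq J(3)
    using permutes_image_two_of_three[OF \<pi>(1), of k "{1, 2, 3}"] by auto
qed

section \<open>The diversity estimate and the case of equality\<close>

lemma diversity_two_of_three:
  assumes "0 \<le> C" "3 \<le> k" "42 * k \<le> n" "J \<subseteq> {1..n}" "card J = 3"
  shows "(3 - 2 * C) * real ((n - 3) choose (k - 2)) \<le> diversity C n (two_of_three {1..n} k J)"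
proof -
  define T where "T = two_of_three {1..n} k J"
  define w where "w = (n - 3) choose (k - 2)"
  have "max_degree n T \<le> 2 * w"
    unfolding max_degree_def
  proof (rule Max.boundedI)
    show "(\<lambda>x. card (link T x)) ` {1..n} \<noteq> {}" using assms by simp
    show "a \<le> 2 * w" if "a \<in> (\<lambda>x. card (link T x)) ` {1..n}" for a
      using that two_of_three_degree[of "{1..n}" J k] assms by (auto simp: T_def w_def)
  qed simp
  then have "C * real (max_degree n T) \<le> C * (2 * real w)"
    using assms(1) by (intro mult_left_mono) linarith+
  moreover have "card T = 3 * w" using card_two_of_three[of "{1..n}" J k] assms by (simp add: T_def w_def)
  ultimately show ?thesis
    unfolding diversity_def T_def[symmetric] w_def[symmetric] by (simp add: algebra_simps)
qed

lemma diversity_large_unit: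
  fixes \<epsilon> :: real
  assumes "3 \<le> k" "42 * real k \<le> \<epsilon> * real n" "\<epsilon> \<le> 1"
  shows "42 * real ((n - 4) choose (k - 3)) \<le> \<epsilon> * real ((n - 3) choose (k - 2))"
proof -
  define u w where "u = (n - 4) choose (k - 3)" and "w = (n - 3) choose (k - 2)"
  have "\<epsilon> * real n \<le> real n" using mult_right_mono[OF assms(3), of "real n"] by simp
  then have n: "42 * real k \<le> real n" using assms(2) by linarith
  have "(k - 2) * w = (n - 3) * u"
    using times_binomial_minus1_eq[of "k - 2" "n - 3"] assms(1) by (simp add: w_def u_def)
  then have "real ((k - 2) * w) = real ((n - 3) * u)" by simp
  then have eq: "(real k - 2) * real w = (real n - 3) * real u" using assms(1) n by (simp add: of_nat_diff)
  have "(real k - 2) * (42 * real u) \<le> (\<epsilon> * (real n - 3)) * real u"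
  proof -
    have "42 * (real k - 2) \<le> \<epsilon> * (real n - 3)" using assms by (simp add: algebra_simps)
    then have "42 * (real k - 2) * real u \<le> \<epsilon> * (real n - 3) * real u" by (rule mult_right_mono) simp
    then show ?thesis by (simp add: algebra_simps)
  qed
  also have "\<dots> = (real k - 2) * (\<epsilon> * real w)"
    using arg_cong[OF eq, of "\<lambda>t. \<epsilon> * t"] by (simp add: algebra_simps)
  finally show ?thesis using assms(1) unfolding u_def w_def by (simp add: mult_le_cancel_left)
qed

text \<open>Reaching the bound is the hypothesis, and equality is part of the conclusion. This gives
  the upper bound and the uniqueness of the extremal family at once.\<close>

lemma diversity_extremal:
  fixes C :: real
  assumes "1 < C" "C < 3 / 2" "3 \<le> k" "42 * real k \<le> (3 - 2 * C) * real n"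
    and F: "F \<subseteq> ksets {1..n} k" "cross F F"
    and large: "(3 - 2 * C) * real ((n - 3) choose (k - 2)) \<le> diversity C n F"
  shows "diversity C n F = (3 - 2 * C) * real ((n - 3) choose (k - 2)) \<and>
    (\<exists>J. J \<subseteq> {1..n} \<and> card J = 3 \<and> F = two_of_three {1..n} k J)"
proof -
  define \<epsilon> where "\<epsilon> = 3 - 2 * C"
  have \<epsilon>: "0 < \<epsilon>" "\<epsilon> < 1" using assms(1,2) by (simp_all add: \<epsilon>_def)
  define w where "w = (n - 3) choose (k - 2)"
  define u where "u = (n - 4) choose (k - 3)"
  define X where "X = {1..n}"
  have X: "finite X" "card X = n" "F \<subseteq> ksets X k" using F by (auto simp: X_def)
  have finF: "finite F" using ksets_sub_finite X by blast
  have "\<epsilon> * real n \<le> 1 * real n" using \<epsilon> by (intro mult_right_mono) auto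
  then have "42 * real k \<le> real n" using assms(4) by (simp add: \<epsilon>_def)
  then have nk: "42 * k \<le> n" by linarith
  have deg: "real (card (link F x)) \<le> real (max_degree n F)" if "x \<in> X" for x
    using degree_le_max_degree that by (simp add: X_def)
  \<comment> \<open>As \<open>C > 1\<close>, the diversity is at most the size minus the maximum
    degree, hence at most the number of sets missing any given vertex.\<close>
  have "42 * u \<le> card (without F x)" if "x \<in> X" for x
  proof -
    have "42 * real u \<le> diversity C n F"
      using diversity_large_unit[of k \<epsilon> n] assms(3,4) \<epsilon> large by (simp add: \<epsilon>_def u_def)
    also have "\<dots> \<le> real (card F) - 1 * real (max_degree n F)"
      unfolding diversity_def using assms(1) by (intro diff_left_mono mult_right_mono) auto
    also have "\<dots> \<le> real (card (without F x))"
      using deg[OF that] card_link_without[OF finF, of x] by simp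
    finally show ?thesis by linarith
  qed
  then obtain x y z where xyz: "x \<noteq> y" "x \<noteq> z" "y \<noteq> z" "{x, y, z} \<subseteq> X"
      and one: "\<And>v. v \<in> {x, y, z} \<Longrightarrow> num F {x, y, z} {v} < (n - 5) choose (k - 3)"
      and zero: "num F {x, y, z} {} < (n - 6) choose (k - 3)"
    using triple_exists[OF X(1,3) F(2) assms(3), of u] nk X(2) u_def by metis
  define J where "J = {x, y, z}"
  have J: "J \<subseteq> X" "card J = 3" using xyz by (auto simp: J_def)
  define f where "f T = num F J T" for T
  define M where "M T = w - f T" for T
  have XJ: "card (X - J) = n - 3" using X J by (metis card_Diff_subset finite_subset)
  have fw: "f T \<le> w" if "card T = 2" for T
    using card_ksets_sub[OF _ trace_ksets[OF X(1,3), of J T]] X(1) XJ that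
    by (simp add: card_trace f_def w_def)
  \<comment> \<open>The factors coming out of \<open>choose_ratio\<close> are all at least
    \<open>4 * n / 5\<close>, and \<open>quad\<close> succeeds because
    \<open>25 \<le> 2 * 16\<close>.\<close>
  have k67: "5 * (n - k - 2) \<ge> 4 * n" "5 * (n - k - 3) \<ge> 4 * n" "5 * (n - k - 4) \<ge> 4 * n" using nk assms(3) by linarith+
  have quad: "n * a \<le> 2 * b * c" if "a \<le> n" "4 * n \<le> 5 * b" "4 * n \<le> 5 * c" for a b c :: nat
  proof -
    have "25 * (n * a) \<le> 25 * (n * n)" using that by simp
    also have "\<dots> \<le> 2 * ((4 * n) * (4 * n))" by simp
    also have "\<dots> \<le> 2 * ((5 * b) * (5 * c))" by (rule mult_le_mono2[OF mult_le_mono[OF that(2,3)]])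
    finally show ?thesis by (simp add: ac_simps)
  qed
  have deficit: "n * f T' \<le> 2 * k * M T"
    if T: "card T = 2" "T \<inter> T' = {}" and T': "T' = {} \<or> T' = {x} \<or> T' = {y} \<or> T' = {z}" for T T'
  proof -
    have cross: "cross (trace F J T) (trace F J T')" by (rule trace_cross[OF F(2) T(2)])
    have sub: "trace F J T \<subseteq> ksets (X - J) (k - 2)" "trace F J T' \<subseteq> ksets (X - J) (k - card T')"
      using trace_ksets[OF X(1,3)] T(1) by metis+
    have lt: "k - 2 + (k - card T') < card (X - J)" using XJ nk assms(3) by linarith
    \<comment> \<open>The empty pattern uses \<open>t = 3\<close> and a singleton
      \<open>t = 2\<close>, so that \<open>k - card T' - t\<close> is \<open>k - 3\<close> in both
      cases.\<close>
    have "n * card (trace F J T') \<le> 2 * k * ((card (X - J) choose (k - 2)) - card (trace F J T))"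
    proof (cases "T' = {}")
      case True
      have "n * (Suc (n - 7) choose (k - 3)) \<le> 2 * k * ((n - 7) choose (k - 2))"
        using assms(3) nk k67 by (intro choose_ratio quad) linarith+
      moreover have "Suc (n - 7) = n - 6" using nk assms(3) by linarith
      ultimately show ?thesis
        using cross_deficit[OF _ sub cross lt, of 3 n "2 * k"] True zero X(1) XJ assms(3) nk
        by (simp add: card_trace J_def)
    next
      case False
      have "n * (Suc (n - 6) choose (k - 3)) \<le> 2 * k * ((n - 6) choose (k - 2))"
        using assms(3) nk k67 by (intro choose_ratio quad) linarith+
      moreover have "Suc (n - 6) = n - 5" using nk assms(3) by linarith
      moreover obtain v where v: "T' = {v}" "v \<in> {x, y, z}" using False T' by blast
      moreover have "num F J T' < (n - 5) choose (k - 3)"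
        using one[OF v(2)] by (simp add: J_def v(1))
      moreover have "k - 1 - 2 = k - 3" "2 \<le> k - 1" using assms(3) by simp_all
      ultimately show ?thesis
        using cross_deficit[OF _ sub cross lt, of 2 n "2 * k"] X(1) XJ assms(3) nk
        by (simp add: card_trace)
    qed
    then show ?thesis by (simp add: card_trace XJ M_def w_def f_def)
  qed
  \<comment> \<open>\<open>2 * k\<close> against \<open>n\<close> becomes \<open>\<epsilon>\<close>
    against 21 because \<open>42 * k \<le> \<epsilon> * n\<close>.\<close>
  have deficit': "21 * real (f T') \<le> \<epsilon> * real (M T)"
    if "card T = 2" "T \<inter> T' = {}" "T' = {} \<or> T' = {x} \<or> T' = {y} \<or> T' = {z}" for T T'
  proof -
    have kpos: "0 < 2 * real k" using assms(3) by simp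
    have "2 * real k * (21 * real (f T')) \<le> \<epsilon> * real n * real (f T')"
      using mult_right_mono[OF assms(4), of "real (f T')"] by (simp add: \<epsilon>_def)
    also have "\<dots> = \<epsilon> * real (n * f T')" by simp
    also have "\<dots> \<le> \<epsilon> * real (2 * k * M T)"
      using deficit[OF that] \<epsilon>(1) by (intro mult_left_mono) (simp_all only: of_nat_le_iff less_imp_le)
    also have "\<dots> = 2 * real k * (\<epsilon> * real (M T))" by simp
    finally show ?thesis using kpos by (simp only: mult_le_cancel_left_pos)
  qed
  have pairs: "card {x, y} = 2" "card {x, z} = 2" "card {y, z} = 2" using xyz by auto
  define S2 where "S2 = real (M {x, y}) + real (M {x, z}) + real (M {y, z})"
  have fM: "real (f {x, y}) = real w - M {x, y}" "real (f {x, z}) = real w - M {x, z}"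
      "real (f {y, z}) = real w - M {y, z}"
    using fw[OF pairs(1)] fw[OF pairs(2)] fw[OF pairs(3)] by (simp_all add: M_def of_nat_diff)
  define ex ey ez where "ex = \<epsilon> * real (M {y, z})" and "ey = \<epsilon> * real (M {x, z})"
    and "ez = \<epsilon> * real (M {x, y})"
  \<comment> \<open>Each singleton is charged to the opposite pair. The empty pattern is disjoint
    from every pair and is charged to \<open>{y, z}\<close>, whence the factor 2 in
    \<open>low\<close>.\<close>
  have b: "21 * real (f {x}) \<le> ex" "21 * real (f {y}) \<le> ey"
      "21 * real (f {z}) \<le> ez" "21 * real (f {}) \<le> ex"
    unfolding ex_def ey_def ez_def using xyz pairs by (intro deficit'; simp)+
  have S2: "\<epsilon> * S2 = ex + ey + ez" by (simp add: S2_def ex_def ey_def ez_def algebra_simps)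
  have nonneg: "0 \<le> ex" "0 \<le> ey" "0 \<le> ez" using \<epsilon> by (simp_all add: ex_def ey_def ez_def)
  define s1 where "s1 = real (f {x}) + real (f {y}) + real (f {z})"
  have "21 * s1 \<le> ex + ey + ez" using b(1-3) by (simp add: s1_def)
  then have "21 * (s1 + real (f {})) \<le> 2 * (ex + ey + ez)" using b(4) nonneg by simp
  then have low: "21 * (s1 + real (f {})) \<le> 2 * (\<epsilon> * S2)" by (simp only: S2)
  have degs: "card (link F x) = f {x} + f {x, y} + f {x, z} + f {x, y, z}"
    "card (link F y) = f {y} + f {x, y} + f {y, z} + f {x, y, z}"
    "card (link F z) = f {z} + f {x, z} + f {y, z} + f {x, y, z}"
    using degree_triple(1)[OF finF xyz(1-3)] degree_triple(1)[OF finF, of y x z]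
      degree_triple(1)[OF finF, of z x y] xyz
    by (simp_all add: f_def J_def insert_commute)
  have cardF: "card F = f {} + (f {x} + f {y} + f {z}) + (f {x, y} + f {x, z} + f {y, z}) + f {x, y, z}"
    using card_triple[OF X(3,1) J_def xyz(1-3)] by (simp add: f_def)
  define D where "D = real (max_degree n F)"
  have "real (card (link F x)) \<le> D" "real (card (link F y)) \<le> D" "real (card (link F z)) \<le> D"
    using deg xyz(4) by (auto simp: D_def)
  then have "s1 + 2 * (3 * real w - S2) + 3 * real (f {x, y, z}) \<le> 3 * D"
    unfolding degs s1_def S2_def using fM by simp
  then have "C * (s1 + 2 * (3 * real w - S2) + 3 * real (f {x, y, z})) \<le> C * (3 * D)"
    using assms(1) by (intro mult_left_mono) auto
  moreover have "diversity C n F = real (f {}) + s1 + (3 * real w - S2) + real (f {x, y, z}) - C * D"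
    unfolding diversity_def D_def[symmetric] cardF s1_def S2_def using fM by simp
  \<comment> \<open>In the sum of the three degrees each pair pattern counts twice and the full
    pattern three times. So the pairs contribute with coefficient
    \<open>3 - 2 * C = \<epsilon>\<close>, and sets containing \<open>J\<close> with the negative
    coefficient \<open>3 - 3 * C\<close>.\<close>
  ultimately have up: "3 * diversity C n F \<le> 3 * (\<epsilon> * real w) - \<epsilon> * S2
      + 3 * real (f {}) + 3 * s1 - C * s1 - 3 * ((C - 1) * real (f {x, y, z}))"
    unfolding \<epsilon>_def by (simp add: algebra_simps)
  have Cpos: "0 \<le> C * s1" "0 \<le> (C - 1) * real (f {x, y, z})" using assms(1) by (simp_all add: s1_def)
  have S2pos: "0 \<le> \<epsilon> * S2" using nonneg S2 by linarith
  have lw: "\<epsilon> * real w \<le> diversity C n F" using large by (simp add: \<epsilon>_def w_def)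
  \<comment> \<open>Here \<open>e\<close> is \<open>\<epsilon> * S2\<close>. The exceptional terms
    cost at most \<open>3 * (a + b) \<le> 2 * e / 7\<close>, which is less than the gain
    \<open>e\<close> unless everything vanishes.\<close>
  have "e = 0 \<and> q = 0 \<and> d = p"
    if "3 * d \<le> 3 * p - e + 3 * a + 3 * b - r - 3 * q" "21 * (b + a) \<le> 2 * e" "0 \<le> r" "0 \<le> q" "0 \<le> e" "p \<le> d"
    for a b d e p q r :: real
    using that by (intro conjI; argo)
  from this[OF up low Cpos S2pos lw]
  have res: "S2 = 0" "f {x, y, z} = 0" "diversity C n F = \<epsilon> * real w" using \<epsilon> assms(1) by simp_all
  then have "s1 + real (f {}) \<le> 0" using low by simp
  then have f0: "f {} = 0" "f {x} = 0" "f {y} = 0" "f {z} = 0" unfolding s1_def by linarith+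
  have cF: "card F = 3 * w" using cardF f0 res(1,2) fM unfolding S2_def by linarith
  have "F \<subseteq> two_of_three X k J"
  proof
    fix S assume S: "S \<in> F"
    have "f (S \<inter> J) \<noteq> 0" using S finF by (auto simp: f_def num_def)
    moreover have "S \<inter> J \<in> {{}, {x}, {y}, {z}, {x, y}, {x, z}, {y, z}, {x, y, z}}"
      by (rule subset_triple) (simp add: J_def)
    ultimately have "S \<inter> J = {x, y} \<or> S \<inter> J = {x, z} \<or> S \<inter> J = {y, z}"
      using f0 res(2) by (elim insertE) simp_all
    then have "card (S \<inter> J) = 2" using pairs by metis
    then show "S \<in> two_of_three X k J" using S X(3) by (auto simp: two_of_three_def)
  qed
  moreover have "finite (two_of_three X k J)"
    by (rule ksets_sub_finite[OF X(1), of _ k]) (auto simp: two_of_three_def)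
  moreover have "card F = card (two_of_three X k J)"
    using card_two_of_three[OF X(1) J, of k] assms(3) cF X(2) by (simp add: w_def)
  ultimately have "F = two_of_three X k J" by (metis card_subset_eq)
  then show ?thesis using res(3) J by (auto simp: \<epsilon>_def w_def X_def)
qed

theorem theorem1p8:
  fixes C :: real and n k :: nat and \<F> :: "nat set set"
  assumes "1 < C" and "C < 3 / 2"
    and "k \<ge> 3" and "real n \<ge> 42 * real k / (3 - 2 * C)"
    and "\<F> \<subseteq> k_subsets n k" and "intersecting \<F>"
  shows "diversity C n \<F> \<le> (3 - 2 * C) * real ((n - 3) choose (k - 2)) \<and>
    (diversity C n \<F> = (3 - 2 * C) * real ((n - 3) choose (k - 2)) \<longleftrightarrow>
      isomorphic_families n \<F> (triangle_family n k))"
proof -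
  have nk: "42 * real k \<le> (3 - 2 * C) * real n"
    using assms(2,4) by (simp add: divide_le_eq mult.commute)
  have "(3 - 2 * C) * real n \<le> 1 * real n" using assms(1) by (intro mult_right_mono) auto
  then have nk': "42 * k \<le> n" using nk by linarith
  have F: "\<F> \<subseteq> ksets {1..n} k" "cross \<F> \<F>"
    using assms(5,6) by (simp_all add: k_subsets_eq intersecting_eq)
  have iso: "isomorphic_families n \<F> (triangle_family n k) \<longleftrightarrow>
      (\<exists>J. J \<subseteq> {1..n} \<and> card J = 3 \<and> \<F> = two_of_three {1..n} k J)"
    by (rule isomorphic_triangle_iff) (use nk' assms(3) in linarith)
  note ext = diversity_extremal[OF assms(1-3) nk F]
  have "(3 - 2 * C) * real ((n - 3) choose (k - 2)) \<le> diversity C n \<F>"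
    if "isomorphic_families n \<F> (triangle_family n k)"
  proof -
    from that iso obtain J where J: "J \<subseteq> {1..n}" "card J = 3" "\<F> = two_of_three {1..n} k J" by blast
    show ?thesis unfolding J(3) by (rule diversity_two_of_three[OF _ assms(3) nk' J(1,2)]) (use assms(1) in simp)
  qed
  \<comment> \<open>Either the diversity lies below the bound or \<open>ext\<close> makes it equal;
    for the triangle family the lower bound just shown triggers \<open>ext\<close> as well.\<close>
  then show ?thesis using ext iso by (metis linorder_le_cases order_refl)
qed

end
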